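(* Let $\kappa>0$ and $R$ be constants, and let $s_5\in(0,2)$ and $\varepsilon>0$ be such that $$w_0=\frac{s_5+(6s_5-12)\varepsilon}{s_5},\qquad s_2=\frac{6s_5-12}{s_5-6},\qquad s_4=\frac{12\varepsilon s_5^2-24\varepsilon s_5+2s_5^2}{2s_5-36\varepsilon+24\varepsilon s_5+\varepsilon s_5^2}$$ are well defined with $w_0\in(0,1)$ and $s_2,s_4\in(0,2)$. Then $\varepsilon=\frac{1-w_0}{2}\left(\frac1{s_2}-\frac12\right)$, and, at the diffusive scaling $\Delta t=\varepsilon\Delta x^2/\kappa$, the six-level finite-difference (SLFD) scheme with these parameters is second-order accurate in time and fourth-order accurate in space for $\partial_t\phi=\kappa(\partial_x^2\phi+\partial_y^2\phi)+R$: for every sufficiently smooth solution $\phi$ of this equation, the truncation error of the scheme is $O(\Delta t^2+\Delta x^4+\Delta x^2\Delta t)=O(\Delta x^4)$ as $\Delta x\to0$. Consequently, the MRT-LB model with these parameters, which is equivalent to the SLFD scheme, is fourth-order accurate in space in the same sense.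
   Context: **MRT-LB model (D2Q5).** The lattice is $\Delta x\,\mathbb Z\times\Delta x\,\mathbb Z$, the time step is $\Delta t$, and $c=\Delta x/\Delta t$. The discrete velocities are $\mathbf c_0=c(0,0)$, $\mathbf c_1=c(1,0)$, $\mathbf c_2=c(0,1)$, $\mathbf c_3=c(-1,0)$, $\mathbf c_4=c(0,-1)$. The distribution functions $f_i$ evolve by $$f_i(\mathbf r+\mathbf c_i\Delta t,t+\Delta t)=f_i(\mathbf r,t)-\sum_k(M^{-1}SM)_{ik}\,[f_k-f_k^{eq}](\mathbf r,t)+\Delta t\sum_k\big[M^{-1}(I-\tfrac S2)M\big]_{ik}R_k,$$ with $f^{eq}_i=w_i\phi$, $R_i=w_iR$, $w_1=\dots=w_4=(1-w_0)/4$, $\phi=\sum_i f_i+\frac{\Delta t}{2}R$, $S=\mathrm{diag}(s_1,s_2,s_2,s_4,s_5)$ with $s_1\in(0,2)$ arbitrary, and $$M=\begin{pmatrix}1&1&1&1&1\\0&c&0&-c&0\\0&0&c&0&-c\\-4c^2&c^2&c^2&c^2&c^2\\0&c^2&-c^2&c^2&-c^2\end{pmatrix}.$$ **SLFD scheme.** The variable $\phi$ of the MRT-LB model satisfies the equivalent scheme $$\begin{aligned}\phi_{i,j}^{n+1}=&\ \alpha_1\phi^n_{i,j}+\alpha_2\,\Sigma_1\phi^n_{i,j}+\beta_1\phi^{n-1}_{i,j}+\beta_2\,\Sigma_1\phi^{n-1}_{i,j}+\beta_3\,\Sigma_2\phi^{n-1}_{i,j}+\gamma_1\phi^{n-2}_{i,j}+\gamma_2\,\Sigma_1\phi^{n-2}_{i,j}+\gamma_3\,\Sigma_2\phi^{n-2}_{i,j}\\&+\zeta_1\phi^{n-3}_{i,j}+\zeta_2\,\Sigma_1\phi^{n-3}_{i,j}+\eta\,\phi^{n-4}_{i,j}+\Delta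 t\,\delta R,\end{aligned}$$ where $\phi^n_{i,j}$ is the value at $(i\Delta x,j\Delta x)$ and time $n\Delta t$, $\Sigma_1\phi_{i,j}=\phi_{i-1,j}+\phi_{i+1,j}+\phi_{i,j-1}+\phi_{i,j+1}$, $\Sigma_2\phi_{i,j}=\phi_{i-1,j-1}+\phi_{i-1,j+1}+\phi_{i+1,j-1}+\phi_{i+1,j+1}$, and $$\begin{aligned} &\alpha_1=(w_0-1)s_4+1,\quad \alpha_2=1-\tfrac{s_5}{4}-\tfrac{s_2}{2}-\tfrac{s_4w_0}{4},\quad \beta_1=(s_4w_0+s_5-2)(1-s_2),\\ &\beta_2=\tfrac{(s_5+2s_2-4)(1-s_4)+w_0s_4(s_5+2s_2-3)}{4},\quad \beta_3=\tfrac{(2-s_2-s_4w_0)(s_2+s_5-2)}{4},\\ &\gamma_1=s_4w_0(s_2-1)(s_5-1)+(1-s_4)(s_5-2)(s_2-1),\\ &\gamma_2=\tfrac{(s_2-1)\left(s_4w_0(3-s_2-2s_5)+(2s_2+3s_5-s_2s_5-4)\right)}{4},\\ &\gamma_3=\tfrac{w_0s_4(s_2-1)(s_2+s_5-2)+(1-s_4)(s_2-2)(s_2+s_5-2)}{4},\\ &\zeta_1=(w_0s_4-1)(1-s_5)(s_2-1)^2,\\ &\zeta_2=\tfrac{s_4w_0(s_2-1)^2(s_5-1)+(1-s_4)(1-s_2)(2s_2+3s_5-s_2s_5-4)}{4},\\ &\eta=(1-s_2)^2(1-s_4)(1-s_5),\quad \delta=s_2^2s_4s_5. \end{aligned}$$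 **Truncation error.** For a smooth function $\phi(x,y,t)$ it is obtained by inserting the point values $\phi(i\Delta x,j\Delta x,n\Delta t)$ in the scheme, taking left-hand side minus right-hand side, and dividing by $\Delta t\,\delta$, so that $\partial_t\phi$ appears with coefficient $1$. The parameters $w_0,s_2,s_4,s_5,\varepsilon$ are fixed as $\Delta x\to0$. *)

theory Defs
  imports "HOL-Analysis.Analysis"
begin

section \<open>The MRT lattice Boltzmann model (D2Q5)\<close>

text \<open>
  Lattice functions take a time level and a node, both as integers: \<open>u n (i, j)\<close> is the value at
  \<open>(i \<Delta>x, j \<Delta>x)\<close> and time \<open>n \<Delta>t\<close>. The discrete velocities are \<open>c e\<^sub>k\<close> with \<open>c = \<Delta>x / \<Delta>t\<close>, so
  streaming over one time step is a shift of the node by \<open>e\<^sub>k\<close>. Components of vectors in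
  \<open>real ^ 5\<close> are listed in the order of the velocities \<open>0, \<dots>, 4\<close> (resp. of the rows of \<open>M\<close>);
  velocity \<open>k\<close> has index \<open>k + 1\<close> in the type \<open>5\<close>.
\<close>

definition lattice_dir :: "(int \<times> int) ^ 5" where
  "lattice_dir = vector [(0, 0), (1, 0), (0, 1), (-1, 0), (0, -1)]"

definition lb_weight :: "real \<Rightarrow> real ^ 5" where
  "lb_weight w0 = vector [w0, (1 - w0) / 4, (1 - w0) / 4, (1 - w0) / 4, (1 - w0) / 4]"

definition lb_M :: "real \<Rightarrow> real ^ 5 ^ 5" where
  "lb_M c = vector
     [vector [1, 1, 1, 1, 1],
      vector [0, c, 0, -c, 0],
      vector [0, 0, c, 0, -c],
      vector [-4 * c\<^sup>2, c\<^sup>2, c\<^sup>2, c\<^sup>2, c\<^sup>2],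
      vector [0, c\<^sup>2, - (c\<^sup>2), c\<^sup>2, - (c\<^sup>2)]]"

definition lb_S :: "real \<Rightarrow> real \<Rightarrow> real \<Rightarrow> real \<Rightarrow> real ^ 5 ^ 5" where
  "lb_S s1 s2 s4 s5 = (\<chi> i j. if i = j then (vector [s1, s2, s2, s4, s5] :: real ^ 5) $ i else 0)"

definition lb_phi :: "real \<Rightarrow> real \<Rightarrow> (int \<Rightarrow> int \<times> int \<Rightarrow> real ^ 5) \<Rightarrow> int \<Rightarrow> int \<times> int \<Rightarrow> real" where
  "lb_phi dt R f n r = (\<Sum>k\<in>UNIV. f n r $ k) + dt / 2 * R"

text \<open>Evolution of the distribution functions, started at time level 0 from arbitrary data.\<close>

definition mrt_lb_run ::
  "real \<Rightarrow> real \<Rightarrow> real \<Rightarrow> real \<Rightarrow> real \<Rightarrow> real \<Rightarrow> real \<Rightarrow> real \<Rightarrow> (int \<Rightarrow> int \<times> int \<Rightarrow> real ^ 5) \<Rightarrow> bool"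
where
  "mrt_lb_run w0 s1 s2 s4 s5 R dx dt f \<longleftrightarrow>
     (let M = lb_M (dx / dt); S = lb_S s1 s2 s4 s5 in
      \<forall>n\<ge>0. \<forall>r k.
        f (n + 1) (r + lattice_dir $ k) $ k =
          f n r $ k
          - ((matrix_inv M ** S ** M) *v (f n r - lb_phi dt R f n r *\<^sub>R lb_weight w0)) $ k
          + dt * ((matrix_inv M ** (mat 1 - (1 / 2) *\<^sub>R S) ** M) *v (R *\<^sub>R lb_weight w0)) $ k)"

section \<open>The six-level finite-difference scheme\<close>

definition Sigma1 :: "(int \<times> int \<Rightarrow> real) \<Rightarrow> int \<times> int \<Rightarrow> real" where
  "Sigma1 v = (\<lambda>(i, j). v (i - 1, j) + v (i + 1, j) + v (i, j - 1) + v (i, j + 1))"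

definition Sigma2 :: "(int \<times> int \<Rightarrow> real) \<Rightarrow> int \<times> int \<Rightarrow> real" where
  "Sigma2 v = (\<lambda>(i, j). v (i - 1, j - 1) + v (i - 1, j + 1) + v (i + 1, j - 1) + v (i + 1, j + 1))"

definition slfd_delta :: "real \<Rightarrow> real \<Rightarrow> real \<Rightarrow> real" where
  "slfd_delta s2 s4 s5 = s2\<^sup>2 * s4 * s5"

text \<open>The right-hand side of the scheme, i.e. the value it assigns to time level \<open>n + 1\<close>.\<close>

definition slfd_rhs ::
  "real \<Rightarrow> real \<Rightarrow> real \<Rightarrow> real \<Rightarrow> real \<Rightarrow> real \<Rightarrow> (int \<Rightarrow> int \<times> int \<Rightarrow> real) \<Rightarrow> int \<Rightarrow> int \<times> int \<Rightarrow> real"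
where
  "slfd_rhs w0 s2 s4 s5 R dt u n r =
    (let
       \<alpha>1 = (w0 - 1) * s4 + 1;
       \<alpha>2 = 1 - s5 / 4 - s2 / 2 - s4 * w0 / 4;
       \<beta>1 = (s4 * w0 + s5 - 2) * (1 - s2);
       \<beta>2 = ((s5 + 2 * s2 - 4) * (1 - s4) + w0 * s4 * (s5 + 2 * s2 - 3)) / 4;
       \<beta>3 = (2 - s2 - s4 * w0) * (s2 + s5 - 2) / 4;
       \<gamma>1 = s4 * w0 * (s2 - 1) * (s5 - 1) + (1 - s4) * (s5 - 2) * (s2 - 1);
       \<gamma>2 = (s2 - 1) * (s4 * w0 * (3 - s2 - 2 * s5) + (2 * s2 + 3 * s5 - s2 * s5 - 4)) / 4;
       \<gamma>3 = (w0 * s4 * (s2 - 1) * (s2 + s5 - 2) + (1 - s4) * (s2 - 2) * (s2 + s5 - 2)) / 4;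
       \<zeta>1 = (w0 * s4 - 1) * (1 - s5) * (s2 - 1)\<^sup>2;
       \<zeta>2 = (s4 * w0 * (s2 - 1)\<^sup>2 * (s5 - 1)
             + (1 - s4) * (1 - s2) * (2 * s2 + 3 * s5 - s2 * s5 - 4)) / 4;
       \<eta> = (1 - s2)\<^sup>2 * (1 - s4) * (1 - s5);
       \<delta> = slfd_delta s2 s4 s5
     in
       \<alpha>1 * u n r + \<alpha>2 * Sigma1 (u n) r
       + \<beta>1 * u (n - 1) r + \<beta>2 * Sigma1 (u (n - 1)) r + \<beta>3 * Sigma2 (u (n - 1)) r
       + \<gamma>1 * u (n - 2) r + \<gamma>2 * Sigma1 (u (n - 2)) r + \<gamma>3 * Sigma2 (u (n - 2)) r
       + \<zeta>1 * u (n - 3) r + \<zeta>2 * Sigma1 (u (n - 3)) r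
       + \<eta> * u (n - 4) r
       + dt * \<delta> * R)"

section \<open>Smooth solutions and truncation error\<close>

text \<open>Class \<open>C\<^sup>k\<close> on an open set.\<close>

primrec Ck_on :: "nat \<Rightarrow> ('a::real_normed_vector \<Rightarrow> real) \<Rightarrow> 'a set \<Rightarrow> bool" where
  "Ck_on 0 f U \<longleftrightarrow> continuous_on U f"
| "Ck_on (Suc k) f U \<longleftrightarrow>
     (\<forall>p\<in>U. f differentiable (at p)) \<and> (\<forall>v. Ck_on k (\<lambda>p. frechet_derivative f (at p) v) U)"

definition diffusion_solution_on ::
  "(real \<times> real \<times> real) set \<Rightarrow> real \<Rightarrow> real \<Rightarrow> (real \<times> real \<times> real \<Rightarrow> real) \<Rightarrow> bool"
where
  "diffusion_solution_on U \<kappa> R \<phi> \<longleftrightarrow>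
     (\<forall>x y t. (x, y, t) \<in> U \<longrightarrow>
        deriv (\<lambda>\<tau>. \<phi> (x, y, \<tau>)) t =
          \<kappa> * ((deriv ^^ 2) (\<lambda>\<xi>. \<phi> (\<xi>, y, t)) x + (deriv ^^ 2) (\<lambda>\<upsilon>. \<phi> (x, \<upsilon>, t)) y) + R)"

definition grid_point :: "real \<Rightarrow> real \<Rightarrow> int \<Rightarrow> int \<times> int \<Rightarrow> real \<times> real \<times> real" where
  "grid_point dx dt n = (\<lambda>(i, j). (of_int i * dx, of_int j * dx, of_int n * dt))"

definition grid_values ::
  "real \<Rightarrow> real \<Rightarrow> (real \<times> real \<times> real \<Rightarrow> real) \<Rightarrow> int \<Rightarrow> int \<times> int \<Rightarrow> real"
where
  "grid_values dx dt \<phi> n r = \<phi> (grid_point dx dt n r)"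

definition slfd_truncation_error ::
  "real \<Rightarrow> real \<Rightarrow> real \<Rightarrow> real \<Rightarrow> real \<Rightarrow> real \<Rightarrow> real \<Rightarrow> (real \<times> real \<times> real \<Rightarrow> real)
    \<Rightarrow> int \<Rightarrow> int \<times> int \<Rightarrow> real"
where
  "slfd_truncation_error w0 s2 s4 s5 R dx dt \<phi> n r =
     (let u = grid_values dx dt \<phi> in
      (u (n + 1) r - slfd_rhs w0 s2 s4 s5 R dt u n r) / (dt * slfd_delta s2 s4 s5))"

text \<open>
  Along \<open>\<Delta>t = \<epsilon> \<Delta>x\<^sup>2 / \<kappa>\<close>, the truncation error is \<open>O(g \<Delta>x \<Delta>t)\<close> as \<open>\<Delta>x \<rightarrow> 0\<close>, for every solution
  on an open set \<open>U\<close> of space-time and uniformly over the grid points in a compact subset of \<open>U\<close>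
  (for small \<open>\<Delta>x\<close> the whole stencil of such a point lies in \<open>U\<close>). The sufficient smoothness is
  \<open>C\<^sup>6\<close>.
\<close>

definition slfd_accuracy ::
  "real \<Rightarrow> real \<Rightarrow> real \<Rightarrow> real \<Rightarrow> real \<Rightarrow> real \<Rightarrow> real \<Rightarrow> (real \<Rightarrow> real \<Rightarrow> real) \<Rightarrow> bool"
where
  "slfd_accuracy \<kappa> R \<epsilon> w0 s2 s4 s5 g \<longleftrightarrow>
     (\<forall>U \<phi> K. open U \<longrightarrow> Ck_on 6 \<phi> U \<longrightarrow> diffusion_solution_on U \<kappa> R \<phi> \<longrightarrow>
        compact K \<longrightarrow> K \<subseteq> U \<longrightarrow>
        (\<exists>C. \<forall>\<^sub>F dx in at_right 0. let dt = \<epsilon> * dx\<^sup>2 / \<kappa> in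
           \<forall>n r. grid_point dx dt n r \<in> K \<longrightarrow>
             \<bar>slfd_truncation_error w0 s2 s4 s5 R dx dt \<phi> n r\<bar> \<le> C * g dx dt))"

text \<open>
  The same notion for the lattice Boltzmann model. Let \<open>e\<close> be the exact point values minus the \<open>\<phi>\<close> of
  an arbitrary run. The error at level \<open>n + 1\<close>, less what the (homogeneous) scheme propagates from
  the errors at the five preceding levels, is the error newly made in this step, again divided by
  \<open>\<Delta>t \<delta>\<close>. If \<open>\<phi>\<close> is exact on the stencil at those levels, it is just the exact minus the computed
  value at level \<open>n + 1\<close>. Demanding that exactness of the run instead would be vacuous for
  degenerate relaxation rates (such as \<open>s2 = s4 = 1\<close>), where \<open>\<phi>\<close> already satisfies a scheme with
  fewer levels. Runs start at level 0, whence \<open>4 \<le> n\<close>.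
\<close>

definition mrt_lb_accuracy ::
  "real \<Rightarrow> real \<Rightarrow> real \<Rightarrow> real \<Rightarrow> real \<Rightarrow> real \<Rightarrow> real \<Rightarrow> real \<Rightarrow> (real \<Rightarrow> real \<Rightarrow> real) \<Rightarrow> bool"
where
  "mrt_lb_accuracy \<kappa> R \<epsilon> w0 s1 s2 s4 s5 g \<longleftrightarrow>
     (\<forall>U \<phi> K. open U \<longrightarrow> Ck_on 6 \<phi> U \<longrightarrow> diffusion_solution_on U \<kappa> R \<phi> \<longrightarrow>
        compact K \<longrightarrow> K \<subseteq> U \<longrightarrow>
        (\<exists>C. \<forall>\<^sub>F dx in at_right 0. let dt = \<epsilon> * dx\<^sup>2 / \<kappa> in
           \<forall>f. mrt_lb_run w0 s1 s2 s4 s5 R dx dt f \<longrightarrow>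
             (let e = (\<lambda>n r. grid_values dx dt \<phi> n r - lb_phi dt R f n r) in
              \<forall>n\<ge>4. \<forall>r. grid_point dx dt n r \<in> K \<longrightarrow>
                \<bar>(e (n + 1) r - slfd_rhs w0 s2 s4 s5 0 dt e n r) / (dt * slfd_delta s2 s4 s5)\<bar>
                  \<le> C * g dx dt)))"

end

theory Submission
  imports Defs
begin

text \<open>
  Two independent facts are combined: the lattice Boltzmann model satisfies the six-level scheme
  exactly, and the scheme has local error \<open>O(\<Delta>x\<^sup>6)\<close> on solutions of the diffusion equation.

  The equivalence is an elimination. After adding half of the source to the populations
  (\<open>collision_moments\<close>), the model is a linear evolution of five populations whose coefficients are commuting
  shift operators, so it can be solved for \<open>\<phi>\<close> like a linear system over a commutative ring.
  The two fluxes are eliminated first (\<open>eliminate_flux\<close>), leaving \<open>\<phi>\<close>, the population at rest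
  and the difference of the two axes; the latter two are eliminated by applying the operators that
  annihilate them (\<open>eliminate_populations\<close>). The result is the scheme (\<open>mrt_lb_run_slfd\<close>).

  For the local error, time counts twice, since \<open>\<Delta>t\<close> is a multiple of \<open>\<Delta>x\<^sup>2\<close>. The solution is expanded
  around a grid point up to a remainder \<open>O(\<Delta>x\<^sup>6)\<close>, uniformly on compact sets
  (\<open>symmetric_parabolic_expansion\<close>); odd orders cancel by the symmetry of the stencil. The equation, and
  its derivatives, eliminate the time derivatives (\<open>heat_equation_derivs\<close>). What is left is a polynomial
  with four free coefficients: \<open>\<phi>\<close>, its Laplacian, the sum of the pure fourth derivatives, and the mixed
  fourth derivative. The scheme is consistent with the first for all parameters, and three algebraic
  relations make it exact for the others. The prescribed \<open>w0\<close>, \<open>s2\<close>, \<open>s4\<close> are the solution of these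
  relations in terms of \<open>s5\<close> and \<open>\<epsilon>\<close> (\<open>slfd_parameter_relations\<close>, \<open>slfd_exact_heat_polynomial\<close>). Division by \<open>\<Delta>t \<delta>\<close>
  leaves \<open>O(\<Delta>x\<^sup>4)\<close>.
\<close>

section \<open>Directional derivatives\<close>

text \<open>
  With the direction as first argument, iterated derivatives are iterated operators, and each
  application uses up one level of the recursion that defines \<open>C\<^sup>k\<close>.
\<close>

definition dir_deriv :: "'a::real_normed_vector \<Rightarrow> ('a \<Rightarrow> real) \<Rightarrow> 'a \<Rightarrow> real" where
  "dir_deriv v f p = frechet_derivative f (at p) v"

lemma Ck_on_imp_continuous_on: "Ck_on k f U \<Longrightarrow> continuous_on U f"
  by (cases k) (auto intro!: continuous_at_imp_continuous_on differentiable_imp_continuous_within)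

lemma Ck_on_dir_deriv: "Ck_on (Suc k) f U \<Longrightarrow> Ck_on k (dir_deriv v f) U"
  by (simp add: dir_deriv_def[abs_def])

lemma Ck_on_differentiable: "Ck_on (Suc k) f U \<Longrightarrow> p \<in> U \<Longrightarrow> f differentiable (at p)"
  by simp

lemma Ck_on_Suc_imp: "Ck_on (Suc k) f U \<Longrightarrow> Ck_on k f U"
proof (induction k arbitrary: f)
  case 0
  then show ?case using Ck_on_imp_continuous_on by (metis Ck_on.simps(1))
next
  case (Suc k)
  then show ?case by (metis Ck_on.simps(2))
qed

lemma Ck_on_mono: "Ck_on k f U \<Longrightarrow> j \<le> k \<Longrightarrow> Ck_on j f U"
  by (induction k) (auto simp: le_Suc_eq dest: Ck_on_Suc_imp simp del: Ck_on.simps)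

lemma Ck_on_funpow_dir_deriv: "Ck_on (n + i) f U \<Longrightarrow> Ck_on n ((dir_deriv v ^^ i) f) U"
  by (induction i arbitrary: n) (auto simp del: Ck_on.simps intro!: Ck_on_dir_deriv)

lemma has_derivative_dir_deriv:
  "f differentiable (at p) \<Longrightarrow> (f has_derivative (\<lambda>v. dir_deriv v f p)) (at p)"
  unfolding dir_deriv_def by (simp add: frechet_derivative_works)

lemma dir_deriv_unique: "(f has_derivative f') (at p) \<Longrightarrow> dir_deriv v f p = f' v"
  by (simp add: dir_deriv_def frechet_derivative_at[symmetric])

lemma dir_deriv_direction:
  assumes "f differentiable (at p)"
  shows "dir_deriv (a *\<^sub>R v + b *\<^sub>R w) f p = a * dir_deriv v f p + b * dir_deriv w f p"
  using linear_frechet_derivative[OF assms] by (simp add: dir_deriv_def linear_add linear_scale)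

lemma dir_deriv_lincomb:
  assumes "f differentiable (at p)" "g differentiable (at p)"
  shows "dir_deriv v (\<lambda>q. a * f q + b * g q + c) p = a * dir_deriv v f p + b * dir_deriv v g p"
  by (rule dir_deriv_unique)
    (auto intro!: derivative_eq_intros has_derivative_dir_deriv assms)

lemma dir_deriv_cong:
  assumes "open U" "p \<in> U" "\<And>q. q \<in> U \<Longrightarrow> f q = g q" "f differentiable (at p)"
  shows "dir_deriv v f p = dir_deriv v g p"
  unfolding dir_deriv_def using frechet_derivative_transform_within_open[OF assms(4,1,2,3)] by simp

lemma DERIV_along_line:
  fixes f :: "'a::real_normed_vector \<Rightarrow> real"
  assumes "f differentiable (at (p + r *\<^sub>R v))"
  shows "((\<lambda>r. f (p + r *\<^sub>R v)) has_real_derivative dir_deriv v f (p + r *\<^sub>R v)) (at r)"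
proof -
  have "(f has_derivative (\<lambda>w. dir_deriv w f (p + r *\<^sub>R v))) (at (p + r *\<^sub>R v))"
    by (rule has_derivative_dir_deriv[OF assms])
  moreover have "((\<lambda>r. p + r *\<^sub>R v) has_derivative (\<lambda>h. h *\<^sub>R v)) (at r)"
    by (auto intro!: derivative_eq_intros)
  ultimately have "((\<lambda>r. f (p + r *\<^sub>R v)) has_derivative (\<lambda>h. dir_deriv (h *\<^sub>R v) f (p + r *\<^sub>R v))) (at r)"
    by (rule has_derivative_compose[rotated])
  moreover have "dir_deriv (h *\<^sub>R v) f (p + r *\<^sub>R v) = h * dir_deriv v f (p + r *\<^sub>R v)" for h
    using dir_deriv_direction[OF assms, of h v 0 0] by simp
  ultimately show ?thesis
    by (simp add: has_field_derivative_def mult.commute[of _ "dir_deriv v f _"])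
qed

text \<open>
  Both iterated derivatives are the limit of the same second difference quotient, which is symmetric
  in the two directions: the mean value theorem, applied once in each direction, turns the quotient
  into a value of the iterated derivative at a nearby point.
\<close>

lemma dir_deriv_commute:
  fixes f :: "'a::real_normed_vector \<Rightarrow> real"
  assumes U: "open U" and f: "Ck_on 2 f U" and p: "p \<in> U"
  shows "dir_deriv v (dir_deriv w f) p = dir_deriv w (dir_deriv v f) p"
proof -
  define \<Delta> where "\<Delta> h v w = f (p + h *\<^sub>R v + h *\<^sub>R w) - f (p + h *\<^sub>R v) - f (p + h *\<^sub>R w) + f p" for h v w
  have lim: "((\<lambda>h. \<Delta> h v w / h\<^sup>2) \<longlongrightarrow> dir_deriv w (dir_deriv v f) p) (at_right 0)" for v w
  proof (rule tendstoI)
    fix e :: real assume "e > 0"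
    have f2: "Ck_on (Suc (Suc 0)) f U" using f by (simp add: numeral_2_eq_2)
    have "continuous_on U (dir_deriv w (dir_deriv v f))"
      by (intro Ck_on_imp_continuous_on[of 0] Ck_on_dir_deriv f2)
    then have "isCont (dir_deriv w (dir_deriv v f)) p"
      using U p continuous_on_eq_continuous_at by blast
    then obtain d0 where d0: "d0 > 0" "\<And>q. dist q p < d0 \<Longrightarrow>
        dist (dir_deriv w (dir_deriv v f) q) (dir_deriv w (dir_deriv v f) p) < e"
      using \<open>e > 0\<close> unfolding continuous_at_eps_delta by metis
    obtain d1 where d1: "d1 > 0" "ball p d1 \<subseteq> U" using U p open_contains_ball by blast
    define d where "d = min d0 d1"
    define c where "c = norm v + norm w + 1"
    have c: "c > 0" by (simp add: c_def add_nonneg_pos)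
    have d: "d > 0" using d0 d1 by (simp add: d_def)
    have near: "dist (p + x *\<^sub>R v + y *\<^sub>R w) p < d" if "0 \<le> x" "x \<le> h" "0 \<le> y" "y \<le> h" "h < d / c" for x y h
    proof -
      have "dist (p + x *\<^sub>R v + y *\<^sub>R w) p = norm (x *\<^sub>R v + y *\<^sub>R w)"
        by (simp add: dist_norm algebra_simps)
      also have "\<dots> \<le> x * norm v + y * norm w"
        using norm_triangle_ineq[of "x *\<^sub>R v" "y *\<^sub>R w"] that by simp
      also have "\<dots> \<le> h * norm v + h * norm w"
        using that by (intro add_mono mult_right_mono) auto
      also have "\<dots> \<le> h * c" using that by (simp add: c_def algebra_simps)
      also have "\<dots> < d" using that(5) c by (simp add: pos_less_divide_eq)
      finally show ?thesis .
    qed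
    have "dist (\<Delta> h v w / h\<^sup>2) (dir_deriv w (dir_deriv v f) p) < e" if h: "0 < h" "h < d / c" for h
    proof -
      have inU: "p + x *\<^sub>R v + y *\<^sub>R w \<in> U" if "0 \<le> x" "x \<le> h" "0 \<le> y" "y \<le> h" for x y
        using near[OF that h(2)] d1(2) by (auto simp: d_def dist_commute subset_eq)
      have "\<exists>x. 0 < x \<and> x < h \<and> (f (p + h *\<^sub>R v + h *\<^sub>R w) - f (p + h *\<^sub>R v)) - (f (p + 0 *\<^sub>R v + h *\<^sub>R w) - f (p + 0 *\<^sub>R v))
          = (h - 0) * (dir_deriv v f (p + x *\<^sub>R v + h *\<^sub>R w) - dir_deriv v f (p + x *\<^sub>R v))"
      proof (rule MVT2[OF h(1)])
        fix x assume x: "0 \<le> x" "x \<le> h"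
        have 1: "f differentiable (at ((p + h *\<^sub>R w) + x *\<^sub>R v))" "f differentiable (at (p + x *\<^sub>R v))"
          using inU[of x h] inU[of x 0] x h by (auto intro!: Ck_on_differentiable[OF f2] simp: algebra_simps)
        show "((\<lambda>x. f (p + x *\<^sub>R v + h *\<^sub>R w) - f (p + x *\<^sub>R v)) has_real_derivative
            dir_deriv v f (p + x *\<^sub>R v + h *\<^sub>R w) - dir_deriv v f (p + x *\<^sub>R v)) (at x)"
          using DERIV_diff[OF DERIV_along_line[OF 1(1)] DERIV_along_line[OF 1(2)]]
          by (simp add: algebra_simps)
      qed
      then obtain x where x: "0 < x" "x < h"
        "\<Delta> h v w = h * (dir_deriv v f (p + x *\<^sub>R v + h *\<^sub>R w) - dir_deriv v f (p + x *\<^sub>R v))"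
        by (auto simp: \<Delta>_def)
      have "\<exists>y. 0 < y \<and> y < h \<and> dir_deriv v f (p + x *\<^sub>R v + h *\<^sub>R w) - dir_deriv v f (p + x *\<^sub>R v + 0 *\<^sub>R w)
          = (h - 0) * dir_deriv w (dir_deriv v f) (p + x *\<^sub>R v + y *\<^sub>R w)"
      proof (rule MVT2[OF h(1)])
        fix y assume y: "0 \<le> y" "y \<le> h"
        show "((\<lambda>y. dir_deriv v f (p + x *\<^sub>R v + y *\<^sub>R w)) has_real_derivative
            dir_deriv w (dir_deriv v f) (p + x *\<^sub>R v + y *\<^sub>R w)) (at y)"
          using inU[of x y] x y
          by (intro DERIV_along_line Ck_on_differentiable[OF Ck_on_dir_deriv[OF f2]]) auto
      qed
      then obtain y where y: "0 < y" "y < h" "\<Delta> h v w = h * (h * dir_deriv w (dir_deriv v f) (p + x *\<^sub>R v + y *\<^sub>R w))"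
        using x(3) by auto
      then have "\<Delta> h v w / h\<^sup>2 = dir_deriv w (dir_deriv v f) (p + x *\<^sub>R v + y *\<^sub>R w)"
        using h by (simp add: power2_eq_square)
      moreover have "dist (p + x *\<^sub>R v + y *\<^sub>R w) p < d0"
        using near[of x h y] x y h by (simp add: d_def)
      ultimately show ?thesis using d0(2) by simp
    qed
    then show "eventually (\<lambda>h. dist (\<Delta> h v w / h\<^sup>2) (dir_deriv w (dir_deriv v f) p) < e) (at_right 0)"
      unfolding eventually_at_right_field using d c by (intro exI[of _ "d / c"]) auto
  qed
  have "(\<lambda>h. \<Delta> h v w / h\<^sup>2) = (\<lambda>h. \<Delta> h w v / h\<^sup>2)"
    by (simp add: \<Delta>_def algebra_simps fun_eq_iff)
  with lim[of w v] have "((\<lambda>h. \<Delta> h v w / h\<^sup>2) \<longlongrightarrow> dir_deriv v (dir_deriv w f) p) (at_right 0)"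
    by simp
  then show ?thesis
    by (rule tendsto_unique[OF trivial_limit_at_right_real _ lim])
qed

lemma Ck_on_cong:
  assumes "open U" "\<And>p. p \<in> U \<Longrightarrow> f p = g p" "Ck_on k f U"
  shows "Ck_on k g U"
  using assms(2,3)
proof (induction k arbitrary: f g)
  case 0
  then show ?case using continuous_on_cong by (metis Ck_on.simps(1))
next
  case (Suc k)
  have diff: "f differentiable (at p)" if "p \<in> U" for p using Suc.prems(2) that by simp
  show ?case unfolding Ck_on.simps
  proof (intro conjI ballI allI)
    fix p assume "p \<in> U"
    then show "g differentiable (at p)"
      using diff[OF \<open>p \<in> U\<close>] Suc.prems(1) assms(1) unfolding differentiable_def
      by (metis has_derivative_transform_within_open)
  next
    fix v
    show "Ck_on k (\<lambda>p. frechet_derivative g (at p) v) U"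
    proof (rule Suc.IH)
      show "frechet_derivative f (at p) v = frechet_derivative g (at p) v" if "p \<in> U" for p
        using dir_deriv_cong[OF assms(1) that Suc.prems(1) diff[OF that], of v] by (simp add: dir_deriv_def)
      show "Ck_on k (\<lambda>p. frechet_derivative f (at p) v) U" using Suc.prems(2) by simp
    qed
  qed
qed

lemma second_dir_deriv_commute:
  fixes f :: "'a::real_normed_vector \<Rightarrow> real"
  assumes U: "open U" and f: "Ck_on 3 f U" and p: "p \<in> U"
  shows "dir_deriv w (dir_deriv v (dir_deriv v f)) p = dir_deriv v (dir_deriv v (dir_deriv w f)) p"
proof -
  have f': "Ck_on (Suc 2) f U" using f by (simp add: eval_nat_numeral)
  have f2: "Ck_on 2 f U" by (rule Ck_on_mono[OF f]) simp
  have "Ck_on (Suc (Suc 1)) f U" using f by (simp add: eval_nat_numeral)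
  then have diff: "dir_deriv w (dir_deriv v f) differentiable (at p)"
    using Ck_on_dir_deriv p Ck_on_differentiable by (metis One_nat_def)
  have "dir_deriv w (dir_deriv v (dir_deriv v f)) p = dir_deriv v (dir_deriv w (dir_deriv v f)) p"
    by (rule dir_deriv_commute[OF U Ck_on_dir_deriv[OF f'] p])
  also have "\<dots> = dir_deriv v (dir_deriv v (dir_deriv w f)) p"
    by (rule dir_deriv_cong[OF U p dir_deriv_commute[OF U f2] diff])
  finally show ?thesis .
qed

lemma second_dir_derivs_commute:
  fixes f :: "'a::real_normed_vector \<Rightarrow> real"
  assumes U: "open U" and f: "Ck_on 4 f U" and p: "p \<in> U"
  shows "dir_deriv y (dir_deriv y (dir_deriv x (dir_deriv x f))) p
    = dir_deriv x (dir_deriv x (dir_deriv y (dir_deriv y f))) p"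
proof -
  have f4: "Ck_on (Suc (Suc (Suc 1))) f U" using f by (simp add: eval_nat_numeral)
  have "Ck_on 3 f U" by (rule Ck_on_mono[OF f]) simp
  note comm = second_dir_deriv_commute[OF U this]
  have y: "Ck_on 3 (dir_deriv y f) U"
    using Ck_on_dir_deriv[OF f4, of y] by (simp add: eval_nat_numeral)
  have "dir_deriv y (dir_deriv x (dir_deriv x f)) differentiable (at p)"
    using Ck_on_dir_deriv[OF Ck_on_dir_deriv[OF Ck_on_dir_deriv[OF f4]]] p by simp
  have "dir_deriv y (dir_deriv y (dir_deriv x (dir_deriv x f))) p
      = dir_deriv y (dir_deriv x (dir_deriv x (dir_deriv y f))) p"
    by (rule dir_deriv_cong[OF U p comm \<open>_ differentiable _\<close>])
  also have "\<dots> = dir_deriv x (dir_deriv x (dir_deriv y (dir_deriv y f))) p"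
    by (rule second_dir_deriv_commute[OF U y p])
  finally show ?thesis .
qed

lemma Ck_on_lincomb:
  assumes U: "open U" and "Ck_on k f U" "Ck_on k g U"
  shows "Ck_on k (\<lambda>p. a * f p + b * g p + c) U"
  using assms(2,3)
proof (induction k arbitrary: f g c)
  case 0
  then show ?case by (auto intro!: continuous_intros)
next
  case (Suc k)
  have diff: "f differentiable (at p)" "g differentiable (at p)" if "p \<in> U" for p
    using Suc.prems that by auto
  have "Ck_on k (dir_deriv v (\<lambda>p. a * f p + b * g p + c)) U" for v
  proof (rule Ck_on_cong[OF U])
    show "Ck_on k (\<lambda>p. a * dir_deriv v f p + b * dir_deriv v g p + 0) U"
      by (intro Suc.IH Ck_on_dir_deriv Suc.prems)
  qed (simp add: dir_deriv_lincomb diff)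
  then show ?case
    by (auto simp: dir_deriv_def[abs_def] intro!: derivative_intros diff)
qed

lemma second_dir_deriv_lincomb:
  assumes U: "open U" and f: "Ck_on 2 f U" and g: "Ck_on 2 g U" and p: "p \<in> U"
    and h: "\<And>q. q \<in> U \<Longrightarrow> h q = a * f q + b * g q + c"
  shows "dir_deriv w h p = a * dir_deriv w f p + b * dir_deriv w g p"
    and "dir_deriv v (dir_deriv w h) p = a * dir_deriv v (dir_deriv w f) p + b * dir_deriv v (dir_deriv w g) p"
proof -
  have f': "Ck_on (Suc 1) f U" "Ck_on (Suc 1) g U" using f g by (simp_all add: numeral_2_eq_2)
  have diff: "f differentiable (at q)" "g differentiable (at q)" if "q \<in> U" for q
    using Ck_on_differentiable[OF f'(1) that] Ck_on_differentiable[OF f'(2) that] by auto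
  have 1: "dir_deriv w h q = a * dir_deriv w f q + b * dir_deriv w g q" if "q \<in> U" for q w
  proof -
    have "dir_deriv w (\<lambda>q. a * f q + b * g q + c) q = dir_deriv w h q"
      by (rule dir_deriv_cong[OF U that]) (auto simp: h intro!: derivative_intros diff that)
    then show ?thesis using dir_deriv_lincomb[OF diff[OF that], of w a b c] by simp
  qed
  show "dir_deriv w h p = a * dir_deriv w f p + b * dir_deriv w g p" by (rule 1[OF p])
  have d: "dir_deriv w f differentiable (at p)" "dir_deriv w g differentiable (at p)"
    using f'[THEN Ck_on_dir_deriv, of w] p by simp_all
  have "dir_deriv v (\<lambda>q. a * dir_deriv w f q + b * dir_deriv w g q + 0) p = dir_deriv v (dir_deriv w h) p"
    by (rule dir_deriv_cong[OF U p]) (auto simp: 1 intro!: derivative_intros d)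
  then show "dir_deriv v (dir_deriv w h) p = a * dir_deriv v (dir_deriv w f) p + b * dir_deriv v (dir_deriv w g) p"
    using dir_deriv_lincomb[OF d, of v a b 0] by simp
qed

lemma second_dir_deriv_direction:
  fixes f :: "'a::real_normed_vector \<Rightarrow> real" and x y :: 'a and c :: real
  assumes U: "open U" and f: "Ck_on 2 f U" and p: "p \<in> U"
  defines "V \<equiv> dir_deriv (x + c *\<^sub>R y)"
  shows "V (V f) p = dir_deriv x (dir_deriv x f) p + 2 * c * dir_deriv x (dir_deriv y f) p
    + c\<^sup>2 * dir_deriv y (dir_deriv y f) p"
proof -
  have f': "Ck_on (Suc 1) f U" using f by (simp add: numeral_2_eq_2)
  have V: "V g q = 1 * dir_deriv x g q + c * dir_deriv y g q + 0" if "Ck_on (Suc 0) g U" "q \<in> U" for g q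
    using dir_deriv_direction[OF Ck_on_differentiable[OF that], of 1 x c y] by (simp add: V_def)
  have Vf: "Ck_on 1 (V f) U" "Ck_on 1 (dir_deriv x f) U" "Ck_on 1 (dir_deriv y f) U"
    unfolding V_def by (intro Ck_on_dir_deriv f')+
  have "dir_deriv w (V f) p = 1 * dir_deriv w (dir_deriv x f) p + c * dir_deriv w (dir_deriv y f) p" for w
  proof -
    have d: "dir_deriv x f differentiable (at p)" "dir_deriv y f differentiable (at p)"
      using Vf p by simp_all
    have "dir_deriv w (\<lambda>q. 1 * dir_deriv x f q + c * dir_deriv y f q + 0) p = dir_deriv w (V f) p"
      by (rule dir_deriv_cong[OF U p])
        (use V[of f] Ck_on_Suc_imp[OF f'] in \<open>auto intro!: derivative_intros d simp del: Ck_on.simps\<close>)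
    then show ?thesis using dir_deriv_lincomb[OF d, of w 1 c 0] by simp
  qed
  moreover have "dir_deriv x (dir_deriv y f) p = dir_deriv y (dir_deriv x f) p"
    by (rule dir_deriv_commute[OF U f p])
  ultimately show ?thesis
    using V[of "V f" p] Vf p by (simp del: Ck_on.simps add: power2_eq_square algebra_simps)
qed

text \<open>
  The directional derivatives along the two diagonals are \<open>X + Y\<close> and \<open>X - Y\<close>, so this is
  \<open>(X + Y)\<^sup>k + (X - Y)\<^sup>k\<close> for \<open>k = 2\<close> and \<open>k = 4\<close>, expanded in commuting derivatives.
\<close>

lemma diagonal_dir_derivs:
  fixes f :: "'a::real_normed_vector \<Rightarrow> real" and x y :: 'a
  assumes U: "open U" and p: "p \<in> U"
  defines "X \<equiv> dir_deriv x" and "Y \<equiv> dir_deriv y" and "V \<equiv> dir_deriv (x + y)" and "W \<equiv> dir_deriv (x - y)"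
  shows "Ck_on 2 f U \<Longrightarrow> V (V f) p + W (W f) p = 2 * (X (X f) p + Y (Y f) p)"
    and "Ck_on 4 f U \<Longrightarrow> V (V (V (V f))) p + W (W (W (W f))) p
      = 2 * (X (X (X (X f))) p + Y (Y (Y (Y f))) p) + 12 * X (X (Y (Y f))) p"
proof -
  have VW: "dir_deriv (x + 1 *\<^sub>R y) = V" "dir_deriv (x + (-1) *\<^sub>R y) = W"
    by (simp_all add: V_def W_def)
  have V2: "V (V g) q = X (X g) q + 2 * X (Y g) q + Y (Y g) q"
    and W2: "W (W g) q = X (X g) q - 2 * X (Y g) q + Y (Y g) q" if "Ck_on 2 g U" "q \<in> U" for g q
    using second_dir_deriv_direction[OF U that, of x 1 y] second_dir_deriv_direction[OF U that, of x "-1" y]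
    unfolding VW by (simp_all add: X_def Y_def)
  show "V (V f) p + W (W f) p = 2 * (X (X f) p + Y (Y f) p)" if "Ck_on 2 f U"
    using V2[OF that p] W2[OF that p] by simp
  assume f: "Ck_on 4 f U"
  have ck: "Ck_on 2 f U" "Ck_on 3 f U" by (rule Ck_on_mono[OF f], simp)+
  have dd: "Ck_on 2 (dir_deriv v (dir_deriv w f)) U" and d: "Ck_on 3 (dir_deriv w f) U" for v w
  proof -
    have "Ck_on (Suc (Suc 2)) f U" using f by (simp add: eval_nat_numeral)
    from Ck_on_dir_deriv[OF this, of w] have *: "Ck_on (Suc 2) (dir_deriv w f) U" .
    then show "Ck_on 3 (dir_deriv w f) U" by (simp add: eval_nat_numeral)
    show "Ck_on 2 (dir_deriv v (dir_deriv w f)) U" by (rule Ck_on_dir_deriv[OF *])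
  qed
  have third: "dir_deriv z (dir_deriv v (dir_deriv w f)) differentiable (at p)" for z v w
    using Ck_on_dir_deriv[of 1 "dir_deriv v (dir_deriv w f)"] dd[of v w] p by (simp add: numeral_2_eq_2)
  let ?a = "X (X f)" and ?b = "X (Y f)" and ?c = "Y (Y f)"
  have C: "Ck_on 2 ?a U" "Ck_on 2 ?b U" "Ck_on 2 ?c U"
    unfolding X_def Y_def by (rule dd)+
  define S where "S q = ?a q + ?c q" for q
  have S2: "Ck_on 2 S U"
  proof -
    have "Ck_on 2 (\<lambda>q. 1 * ?a q + 1 * ?c q + 0) U"
      using Ck_on_lincomb[OF U C(1,3)] .
    then show ?thesis by (simp add: S_def[abs_def])
  qed
  have S: "Z (Z S) q = Z (Z ?a) q + Z (Z ?c) q" if "q \<in> U" "Z = dir_deriv z" for Z z q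
    using second_dir_deriv_lincomb(2)[OF U C(1,3) that(1), of S 1 1 0] that by (simp add: S_def)
  have 4: "V (V (V (V f))) p = V (V S) p + 2 * V (V ?b) p"
    unfolding V_def using second_dir_deriv_lincomb(2)[OF U S2 C(2) p, of "V (V f)" 1 2 0] V2[OF ck(1)]
    by (simp add: S_def V_def)
  have 5: "W (W (W (W f))) p = W (W S) p - 2 * W (W ?b) p"
    unfolding W_def using second_dir_deriv_lincomb(2)[OF U S2 C(2) p, of "W (W f)" 1 "-2" 0] W2[OF ck(1)]
    by (simp add: S_def W_def)
  have sum: "V (V (V (V f))) p + W (W (W (W f))) p
     = 2 * (X (X ?a) p + Y (Y ?c) p + X (X ?c) p + Y (Y ?a) p) + 8 * X (Y ?b) p"
    unfolding 4 5 using V2[OF S2 p] W2[OF S2 p] V2[OF C(2) p] W2[OF C(2) p]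
      S[OF p X_def[THEN meta_eq_to_obj_eq]] S[OF p Y_def[THEN meta_eq_to_obj_eq]] by simp
  have "Y (Y ?a) p = X (X ?c) p"
    unfolding X_def Y_def by (rule second_dir_derivs_commute[OF U f p])
  moreover have "X (Y ?b) p = X (X ?c) p"
    unfolding X_def Y_def
    by (rule dir_deriv_cong[OF U p dir_deriv_commute[OF U Ck_on_mono[OF d]]])
      (use third in simp_all)
  ultimately show "V (V (V (V f))) p + W (W (W (W f))) p
      = 2 * (X (X ?a) p + Y (Y ?c) p) + 12 * X (X ?c) p"
    using sum by simp
qed

text \<open>
  Differentiating the equation eliminates the time derivatives from all terms of parabolic order 4:
  only the fourth space derivatives remain, and of these only two combinations matter.
\<close>

lemma heat_equation_derivs:
  fixes f :: "'a::real_normed_vector \<Rightarrow> real" and x y t :: 'a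
  assumes U: "open U" and f: "Ck_on 4 f U" and p: "p \<in> U"
  defines "X \<equiv> dir_deriv x" and "Y \<equiv> dir_deriv y" and "T \<equiv> dir_deriv t"
  assumes heat: "\<And>q. q \<in> U \<Longrightarrow> T f q = \<kappa> * (X (X f) q + Y (Y f) q) + R"
  shows "X (X (T f)) p + Y (Y (T f)) p
      = \<kappa> * (X (X (X (X f))) p + Y (Y (Y (Y f))) p + 2 * X (X (Y (Y f))) p)" (is ?space)
    and "T (T f) p = \<kappa>\<^sup>2 * (X (X (X (X f))) p + Y (Y (Y (Y f))) p + 2 * X (X (Y (Y f))) p)"
proof -
  have f4: "Ck_on (Suc (Suc 2)) f U" using f by (simp add: eval_nat_numeral)
  have C: "Ck_on 2 (X (X f)) U" "Ck_on 2 (Y (Y f)) U"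
    unfolding X_def Y_def by (intro Ck_on_dir_deriv f4)+
  have f3: "Ck_on 3 f U" by (rule Ck_on_mono[OF f]) simp
  have "X (X (T f)) p = \<kappa> * X (X (X (X f))) p + \<kappa> * X (X (Y (Y f))) p"
    unfolding X_def using second_dir_deriv_lincomb(2)[OF U C p, of "T f" \<kappa> \<kappa> R] heat
    by (simp add: X_def algebra_simps)
  moreover have "Y (Y (T f)) p = \<kappa> * Y (Y (X (X f))) p + \<kappa> * Y (Y (Y (Y f))) p"
    unfolding Y_def using second_dir_deriv_lincomb(2)[OF U C p, of "T f" \<kappa> \<kappa> R] heat
    by (simp add: Y_def algebra_simps)
  moreover have "Y (Y (X (X f))) p = X (X (Y (Y f))) p"
    unfolding X_def Y_def by (rule second_dir_derivs_commute[OF U f p])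
  ultimately show space: ?space by (simp add: algebra_simps)
  have "T (T f) p = \<kappa> * T (X (X f)) p + \<kappa> * T (Y (Y f)) p"
    unfolding T_def using second_dir_deriv_lincomb(1)[OF U C p, of "T f" \<kappa> \<kappa> R t] heat
    by (simp add: T_def algebra_simps)
  moreover have "T (X (X f)) p = X (X (T f)) p" "T (Y (Y f)) p = Y (Y (T f)) p"
    unfolding X_def Y_def T_def by (rule second_dir_deriv_commute[OF U f3 p])+
  ultimately show "T (T f) p = \<kappa>\<^sup>2 * (X (X (X (X f))) p + Y (Y (Y (Y f))) p + 2 * X (X (Y (Y f))) p)"
    using space by (simp add: power2_eq_square flip: distrib_left)
qed

section \<open>Uniform Taylor expansions\<close>

lemma compact_thicken:
  fixes K :: "'a::euclidean_space set"
  assumes "compact K" "open U" "K \<subseteq> U"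
  obtains K' e where "compact K'" "K' \<subseteq> U" "e > 0"
    "\<And>p v. p \<in> K \<Longrightarrow> norm v \<le> e \<Longrightarrow> p + v \<in> K'"
proof -
  obtain e where e: "e > 0" "(\<Union>x\<in>K. cball x e) \<subseteq> U"
    using compact_subset_open_imp_cball_epsilon_subset[OF assms] by blast
  show ?thesis
  proof
    show "compact {x + y | x y. x \<in> K \<and> y \<in> cball (0::'a) e}"
      using assms(1) by (rule compact_sums) simp
    show "{x + y | x y. x \<in> K \<and> y \<in> cball (0::'a) e} \<subseteq> U"
    proof clarify
      fix x y :: 'a assume "x \<in> K" "y \<in> cball 0 e"
      then have "x + y \<in> cball x e" by (simp add: dist_norm)
      then show "x + y \<in> U" using e \<open>x \<in> K\<close> by blast
    qed
  qed (use e in auto)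
qed

text \<open>
  The constants do not depend on the base point, because all the segments involved stay in one
  compact neighbourhood of \<open>K\<close> inside \<open>U\<close>, on which the last derivative is bounded.
\<close>

lemma uniform_Taylor_along_line:
  fixes f :: "'a::euclidean_space \<Rightarrow> real"
  assumes U: "open U" and f: "Ck_on n f U" and K: "compact K" "K \<subseteq> U" and n: "n > 0"
  shows "\<exists>C. \<exists>\<delta>>0. \<forall>p\<in>K. \<forall>h. \<bar>h\<bar> \<le> \<delta> \<longrightarrow>
      \<bar>f (p + h *\<^sub>R v) - (\<Sum>i<n. h ^ i / fact i * (dir_deriv v ^^ i) f p)\<bar> \<le> C * \<bar>h\<bar> ^ n"
proof -
  obtain m where m: "n = Suc m" using n gr0_implies_Suc by blast
  obtain K' e where K': "compact K'" "K' \<subseteq> U" "e > 0"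
    "\<And>p v. p \<in> K \<Longrightarrow> norm v \<le> e \<Longrightarrow> p + v \<in> K'"
    using compact_thicken[OF K(1) U K(2)] by metis
  define g where "g i = (dir_deriv v ^^ i) f" for i
  have cont: "Ck_on (n - i) (g i) U" if "i \<le> n" for i
    unfolding g_def using that f by (intro Ck_on_funpow_dir_deriv) simp
  have "continuous_on K' (g n)"
    using cont[of n] K'(2) by (auto intro: continuous_on_subset)
  then have "bounded (g n ` K')"
    using K'(1) by (intro compact_imp_bounded compact_continuous_image)
  then obtain B where B: "B > 0" "\<And>q. q \<in> K' \<Longrightarrow> \<bar>g n q\<bar> \<le> B"
    unfolding bounded_pos by auto
  define \<delta> where "\<delta> = e / (norm v + 1)"
  have v: "norm v + 1 > 0" by (simp add: add_nonneg_pos)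
  have inK': "p + r *\<^sub>R v \<in> K'" if "p \<in> K" "\<bar>r\<bar> \<le> \<delta>" for p r
  proof (rule K'(4)[OF that(1)])
    have "norm (r *\<^sub>R v) \<le> \<delta> * (norm v + 1)" using that by (auto intro!: mult_mono)
    then show "norm (r *\<^sub>R v) \<le> e" using v by (simp add: \<delta>_def)
  qed
  show ?thesis
  proof (rule exI[of _ "B / fact m"], rule exI[of _ \<delta>], intro conjI ballI allI impI)
    show "\<delta> > 0" using K'(3) v by (simp add: \<delta>_def)
    fix p h assume p: "p \<in> K" and h: "\<bar>h\<bar> \<le> \<delta>"
    have "norm ((\<lambda>r. g 0 (p + r *\<^sub>R v)) h - (\<Sum>i\<le>m. (\<lambda>r. g i (p + r *\<^sub>R v)) 0 * (h - 0) ^ i / fact i))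
        \<le> B * norm (h - 0) ^ Suc m / fact m"
    proof (rule field_Taylor[of "{-\<delta>..\<delta>}" m "\<lambda>i r. g i (p + r *\<^sub>R v)" B 0 h])
      fix i r assume r: "r \<in> {-\<delta>..\<delta>}" "i \<le> m"
      have "Ck_on (Suc (m - i)) (g i) U" using cont[of i] r(2) by (simp add: m Suc_diff_le)
      then have "g i differentiable (at (p + r *\<^sub>R v))"
        using inK'[OF p, of r] r K'(2) Ck_on_differentiable by (metis abs_le_iff atLeastAtMost_iff minus_le_iff subsetD)
      from DERIV_along_line[OF this]
      show "((\<lambda>r. g i (p + r *\<^sub>R v)) has_field_derivative g (Suc i) (p + r *\<^sub>R v)) (at r within {-\<delta>..\<delta>})"
        by (auto simp: g_def intro: has_field_derivative_at_within)
    next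
      fix r assume "r \<in> {-\<delta>..\<delta>}"
      then show "norm (g (Suc m) (p + r *\<^sub>R v)) \<le> B"
        using B(2) inK'[OF p, of r] by (simp add: m abs_le_iff)
    qed (use h in auto)
    then show "\<bar>f (p + h *\<^sub>R v) - (\<Sum>i<n. h ^ i / fact i * (dir_deriv v ^^ i) f p)\<bar> \<le> B / fact m * \<bar>h\<bar> ^ n"
      by (simp add: g_def m lessThan_Suc_atMost mult.commute)
  qed
qed

definition uniform_bigO :: "'a set \<Rightarrow> nat \<Rightarrow> (real \<Rightarrow> 'a \<Rightarrow> real) \<Rightarrow> bool" where
  "uniform_bigO K n E \<longleftrightarrow> (\<exists>C. \<forall>\<^sub>F s in at_right 0. \<forall>p\<in>K. \<bar>E s p\<bar> \<le> C * s ^ n)"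

lemma uniform_bigO_add:
  assumes "uniform_bigO K n E" "uniform_bigO K n G"
  shows "uniform_bigO K n (\<lambda>s p. E s p + G s p)"
proof -
  obtain C D where "\<forall>\<^sub>F s in at_right 0. \<forall>p\<in>K. \<bar>E s p\<bar> \<le> C * s ^ n"
    "\<forall>\<^sub>F s in at_right 0. \<forall>p\<in>K. \<bar>G s p\<bar> \<le> D * s ^ n"
    using assms unfolding uniform_bigO_def by blast
  then have "\<forall>\<^sub>F s in at_right 0. \<forall>p\<in>K. \<bar>E s p + G s p\<bar> \<le> (C + D) * s ^ n"
  proof eventually_elim
    case (elim s)
    show ?case
    proof
      fix p assume "p \<in> K"
      with elim have "\<bar>E s p\<bar> \<le> C * s ^ n" "\<bar>G s p\<bar> \<le> D * s ^ n" by auto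
      then show "\<bar>E s p + G s p\<bar> \<le> (C + D) * s ^ n"
        using abs_triangle_ineq[of "E s p" "G s p"] by (simp add: distrib_right)
    qed
  qed
  then show ?thesis unfolding uniform_bigO_def by blast
qed

lemma uniform_bigO_monomial:
  assumes "uniform_bigO K n E"
  shows "uniform_bigO K (m + n) (\<lambda>s p. c * s ^ m * E s p)"
proof -
  obtain C where "\<forall>\<^sub>F s in at_right 0. \<forall>p\<in>K. \<bar>E s p\<bar> \<le> C * s ^ n"
    using assms unfolding uniform_bigO_def by blast
  moreover have "\<forall>\<^sub>F s in at_right (0::real). s > 0" by (simp add: eventually_at_right_less)
  ultimately have "\<forall>\<^sub>F s in at_right 0. \<forall>p\<in>K. \<bar>c * s ^ m * E s p\<bar> \<le> (\<bar>c\<bar> * C) * s ^ (m + n)"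
  proof eventually_elim
    case (elim s)
    show ?case
    proof
      fix p assume "p \<in> K"
      have "\<bar>c * s ^ m * E s p\<bar> = (\<bar>c\<bar> * s ^ m) * \<bar>E s p\<bar>"
        using elim by (simp add: abs_mult)
      also have "\<dots> \<le> (\<bar>c\<bar> * s ^ m) * (C * s ^ n)"
        using elim \<open>p \<in> K\<close> by (intro mult_left_mono) auto
      finally show "\<bar>c * s ^ m * E s p\<bar> \<le> (\<bar>c\<bar> * C) * s ^ (m + n)"
        by (simp add: power_add mult_ac)
    qed
  qed
  then show ?thesis unfolding uniform_bigO_def by blast
qed

lemmas uniform_bigO_cmult = uniform_bigO_monomial[where m = 0, simplified]

lemma uniform_bigO_Taylor:
  fixes f :: "'a::euclidean_space \<Rightarrow> real"
  assumes "open U" "Ck_on n f U" "compact K" "K \<subseteq> U" "n > 0"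
  shows "uniform_bigO K n
    (\<lambda>s p. f (p + (c * s) *\<^sub>R v) - (\<Sum>i<n. (c * s) ^ i / fact i * (dir_deriv v ^^ i) f p))"
proof -
  obtain C \<delta> where C: "\<delta> > 0"
    "\<forall>p\<in>K. \<forall>h. \<bar>h\<bar> \<le> \<delta> \<longrightarrow>
      \<bar>f (p + h *\<^sub>R v) - (\<Sum>i<n. h ^ i / fact i * (dir_deriv v ^^ i) f p)\<bar> \<le> C * \<bar>h\<bar> ^ n"
    using uniform_Taylor_along_line[OF assms, of v] by blast
  have "((\<lambda>s. \<bar>c * s\<bar>) \<longlongrightarrow> 0) (at_right (0::real))"
    by (auto intro!: tendsto_eq_intros)
  then have "\<forall>\<^sub>F s in at_right 0. \<bar>c * s\<bar> < \<delta>"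
    using C(1) by (rule order_tendstoD)
  moreover have "\<forall>\<^sub>F s in at_right (0::real). s > 0" by (simp add: eventually_at_right_less)
  ultimately have "\<forall>\<^sub>F s in at_right 0. \<forall>p\<in>K.
      \<bar>f (p + (c * s) *\<^sub>R v) - (\<Sum>i<n. (c * s) ^ i / fact i * (dir_deriv v ^^ i) f p)\<bar>
        \<le> (C * \<bar>c\<bar> ^ n) * s ^ n"
  proof eventually_elim
    case (elim s)
    then have "\<bar>c * s\<bar> \<le> \<delta>" by simp
    with C(2) have "\<forall>p\<in>K. \<bar>f (p + (c * s) *\<^sub>R v) - (\<Sum>i<n. (c * s) ^ i / fact i * (dir_deriv v ^^ i) f p)\<bar>
        \<le> C * \<bar>c * s\<bar> ^ n" by blast
    then show ?case
      using elim(2) by (simp add: abs_mult power_mult_distrib mult.assoc)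
  qed
  then show ?thesis unfolding uniform_bigO_def by blast
qed

text \<open>
  A step of length \<open>O(s\<^sup>2)\<close> in direction \<open>w\<close>, as for the time steps under diffusive scaling: \<open>n\<close> derivatives
  already give the order \<open>2 n\<close>. The base point of this expansion is itself displaced by \<open>c s v\<close>, so
  the uniform bound is needed on a neighbourhood of \<open>K\<close>.
\<close>

lemma uniform_bigO_Taylor_parabolic:
  fixes f :: "'a::euclidean_space \<Rightarrow> real"
  assumes "open U" "Ck_on n f U" "compact K" "K \<subseteq> U" "n > 0"
  shows "uniform_bigO K (2 * n)
    (\<lambda>s p. f (p + (c * s) *\<^sub>R v + (\<mu> * s\<^sup>2) *\<^sub>R w)
      - (\<Sum>i<n. (\<mu> * s\<^sup>2) ^ i / fact i * (dir_deriv w ^^ i) f (p + (c * s) *\<^sub>R v)))"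
proof -
  obtain K' e where K': "compact K'" "K' \<subseteq> U" "e > 0"
    "\<And>p v. p \<in> K \<Longrightarrow> norm v \<le> e \<Longrightarrow> p + v \<in> K'"
    using compact_thicken[OF assms(3,1,4)] by metis
  obtain C \<delta> where C: "\<delta> > 0"
    "\<forall>p\<in>K'. \<forall>h. \<bar>h\<bar> \<le> \<delta> \<longrightarrow>
      \<bar>f (p + h *\<^sub>R w) - (\<Sum>i<n. h ^ i / fact i * (dir_deriv w ^^ i) f p)\<bar> \<le> C * \<bar>h\<bar> ^ n"
    using uniform_Taylor_along_line[OF assms(1,2) K'(1,2) assms(5), of w] by blast
  have "((\<lambda>s. norm ((c * s) *\<^sub>R v)) \<longlongrightarrow> 0) (at_right (0::real))"
    by (auto intro!: tendsto_eq_intros)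
  then have "\<forall>\<^sub>F s in at_right 0. norm ((c * s) *\<^sub>R v) < e"
    using K'(3) by (rule order_tendstoD)
  moreover have "((\<lambda>s. \<bar>\<mu> * s\<^sup>2\<bar>) \<longlongrightarrow> 0) (at_right (0::real))"
    by (auto intro!: tendsto_eq_intros)
  then have "\<forall>\<^sub>F s in at_right 0. \<bar>\<mu> * s\<^sup>2\<bar> < \<delta>"
    using C(1) by (rule order_tendstoD)
  ultimately have "\<forall>\<^sub>F s in at_right 0. \<forall>p\<in>K.
      \<bar>f (p + (c * s) *\<^sub>R v + (\<mu> * s\<^sup>2) *\<^sub>R w)
      - (\<Sum>i<n. (\<mu> * s\<^sup>2) ^ i / fact i * (dir_deriv w ^^ i) f (p + (c * s) *\<^sub>R v))\<bar>
        \<le> (C * \<bar>\<mu>\<bar> ^ n) * s ^ (2 * n)"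
  proof eventually_elim
    case (elim s)
    show ?case
    proof
      fix p assume "p \<in> K"
      then have "p + (c * s) *\<^sub>R v \<in> K'" using elim by (intro K'(4)) auto
      from C(2)[rule_format, OF this, of "\<mu> * s\<^sup>2"] elim
      show "\<bar>f (p + (c * s) *\<^sub>R v + (\<mu> * s\<^sup>2) *\<^sub>R w)
      - (\<Sum>i<n. (\<mu> * s\<^sup>2) ^ i / fact i * (dir_deriv w ^^ i) f (p + (c * s) *\<^sub>R v))\<bar>
        \<le> (C * \<bar>\<mu>\<bar> ^ n) * s ^ (2 * n)"
        by (simp add: abs_mult power_mult_distrib power_mult mult.assoc)
    qed
  qed
  then show ?thesis unfolding uniform_bigO_def by blast
qed

text \<open>
  First expand to third order in the direction \<open>w\<close>, then expand the \<open>k\<close>-th derivative in that direction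
  to order \<open>6 - 2 k\<close> along \<open>v\<close>. Since \<open>w\<close> counts twice, \<open>C\<^sup>6\<close> suffices for a remainder \<open>O(s\<^sup>6)\<close>; the odd powers
  of \<open>s\<close> cancel between the two points.
\<close>

lemma symmetric_parabolic_expansion:
  fixes f :: "'a::euclidean_space \<Rightarrow> real" and w :: 'a
  assumes U: "open U" and f: "Ck_on 6 f U" and K: "compact K" "K \<subseteq> U"
  defines "Dw \<equiv> dir_deriv w f"
  shows "uniform_bigO K 6 (\<lambda>s p.
      f (p + s *\<^sub>R v + (\<mu> * s\<^sup>2) *\<^sub>R w) + f (p - s *\<^sub>R v + (\<mu> * s\<^sup>2) *\<^sub>R w)
      - (2 * f p + s\<^sup>2 * (dir_deriv v ^^ 2) f p + s ^ 4 / 12 * (dir_deriv v ^^ 4) f p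
         + \<mu> * s\<^sup>2 * (2 * Dw p + s\<^sup>2 * (dir_deriv v ^^ 2) Dw p)
         + (\<mu> * s\<^sup>2)\<^sup>2 * dir_deriv w Dw p))"
proof -
  have f': "Ck_on 3 f U" "Ck_on 4 Dw U" "Ck_on 2 (dir_deriv w Dw) U"
  proof -
    show "Ck_on 3 f U" by (rule Ck_on_mono[OF f]) simp
    have "Ck_on (Suc 4) f U" by (rule Ck_on_mono[OF f]) simp
    then show 4: "Ck_on 4 Dw U" unfolding Dw_def by (rule Ck_on_dir_deriv)
    have "Ck_on (Suc 2) Dw U" by (rule Ck_on_mono[OF 4]) simp
    then show "Ck_on 2 (dir_deriv w Dw) U" by (rule Ck_on_dir_deriv)
  qed
  have num: "{..<3::nat} = {0,1,2}" "{..<6::nat} = {0,1,2,3,4,5}" "{..<4::nat} = {0,1,2,3}" "{..<2::nat} = {0,1}"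
    by auto
  have pow: "(dir_deriv w ^^ 2) f = dir_deriv w Dw" "(dir_deriv w ^^ Suc 0) f = Dw"
    by (simp_all add: Dw_def numeral_2_eq_2)
  have time: "uniform_bigO K 6 (\<lambda>s p. f (p + (c * s) *\<^sub>R v + (\<mu> * s\<^sup>2) *\<^sub>R w)
      - (f (p + (c * s) *\<^sub>R v) + \<mu> * s\<^sup>2 * Dw (p + (c * s) *\<^sub>R v)
         + (\<mu> * s\<^sup>2)\<^sup>2 / 2 * dir_deriv w Dw (p + (c * s) *\<^sub>R v)))" for c
    using uniform_bigO_Taylor_parabolic[OF U f'(1) K zero_less_numeral, of c v \<mu> w]
    by (simp add: num pow fact_numeral algebra_simps flip: Dw_def)
  have even6: "uniform_bigO K 6 (\<lambda>s p. f (p + s *\<^sub>R v) + f (p - s *\<^sub>R v)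
      - (2 * f p + s\<^sup>2 * (dir_deriv v ^^ 2) f p + s ^ 4 / 12 * (dir_deriv v ^^ 4) f p))"
    using uniform_bigO_add[OF uniform_bigO_Taylor[OF U f K zero_less_numeral, of 1 v]
        uniform_bigO_Taylor[OF U f K zero_less_numeral, of "-1" v]]
    by (simp add: num fact_numeral algebra_simps)
  have even4: "uniform_bigO K 4 (\<lambda>s p. Dw (p + s *\<^sub>R v) + Dw (p - s *\<^sub>R v)
      - (2 * Dw p + s\<^sup>2 * (dir_deriv v ^^ 2) Dw p))"
    using uniform_bigO_add[OF uniform_bigO_Taylor[OF U f'(2) K zero_less_numeral, of 1 v]
        uniform_bigO_Taylor[OF U f'(2) K zero_less_numeral, of "-1" v]]
    by (simp add: num fact_numeral algebra_simps)
  have even2: "uniform_bigO K 2 (\<lambda>s p. dir_deriv w Dw (p + s *\<^sub>R v) + dir_deriv w Dw (p - s *\<^sub>R v)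
      - 2 * dir_deriv w Dw p)"
    using uniform_bigO_add[OF uniform_bigO_Taylor[OF U f'(3) K zero_less_numeral, of 1 v]
        uniform_bigO_Taylor[OF U f'(3) K zero_less_numeral, of "-1" v]]
    by (simp add: num fact_numeral algebra_simps)
  have m4: "uniform_bigO K 6 (\<lambda>s p. \<mu> * s\<^sup>2 * (Dw (p + s *\<^sub>R v) + Dw (p - s *\<^sub>R v)
      - (2 * Dw p + s\<^sup>2 * (dir_deriv v ^^ 2) Dw p)))"
    using uniform_bigO_monomial[OF even4, of 2 \<mu>] by simp
  have m2: "uniform_bigO K 6 (\<lambda>s p. \<mu>\<^sup>2 / 2 * s ^ 4 * (dir_deriv w Dw (p + s *\<^sub>R v) + dir_deriv w Dw (p - s *\<^sub>R v)
      - 2 * dir_deriv w Dw p))"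
    using uniform_bigO_monomial[OF even2, of 4 "\<mu>\<^sup>2 / 2"] by simp
  have sq: "(\<mu> * s\<^sup>2)\<^sup>2 = \<mu>\<^sup>2 * s ^ 4" for s :: real
    by (simp add: power_mult_distrib flip: power_mult)
  show ?thesis
    using uniform_bigO_add[OF uniform_bigO_add[OF time[of 1] time[of "-1"]]
        uniform_bigO_add[OF even6 uniform_bigO_add[OF m4 m2]]]
    by (rule back_subst[where P = "uniform_bigO K 6"]) (intro ext, simp add: sq algebra_simps)
qed

section \<open>Expansion of a solution on the stencil\<close>

lemma uniform_bigO_cong:
  assumes "\<And>s p. p \<in> K \<Longrightarrow> E s p = G s p"
  shows "uniform_bigO K n E \<longleftrightarrow> uniform_bigO K n G"
  using assms by (simp add: uniform_bigO_def)

lemma uniform_bigO_diff: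
  assumes "uniform_bigO K n E" "uniform_bigO K n G"
  shows "uniform_bigO K n (\<lambda>s p. E s p - G s p)"
  using uniform_bigO_add[OF assms(1) uniform_bigO_cmult[OF assms(2), of "-1"]] by simp

text \<open>
  Arbitrary vectors serve as the two space directions and the time direction. The quantities \<open>quart\<close> and
  \<open>mixed\<close> are the combinations of fourth derivatives that survive the elimination of time derivatives.
\<close>

locale parabolic_stencil =
  fixes U K :: "'a::euclidean_space set" and f :: "'a \<Rightarrow> real" and x y t :: 'a and \<kappa> R :: real
  assumes U: "open U" and smooth: "Ck_on 6 f U" and K: "compact K" "K \<subseteq> U"
    and heat: "\<And>p. p \<in> U \<Longrightarrow> dir_deriv t f p =
      \<kappa> * (dir_deriv x (dir_deriv x f) p + dir_deriv y (dir_deriv y f) p) + R"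
begin

definition "lap p = dir_deriv x (dir_deriv x f) p + dir_deriv y (dir_deriv y f) p"
definition "quart p = dir_deriv x (dir_deriv x (dir_deriv x (dir_deriv x f))) p
  + dir_deriv y (dir_deriv y (dir_deriv y (dir_deriv y f))) p"
definition "mixed p = dir_deriv x (dir_deriv x (dir_deriv y (dir_deriv y f))) p"

lemma heat_derivs:
  assumes "p \<in> K"
  shows "dir_deriv t f p = \<kappa> * lap p + R"
    and "dir_deriv x (dir_deriv x (dir_deriv t f)) p + dir_deriv y (dir_deriv y (dir_deriv t f)) p
      = \<kappa> * (quart p + 2 * mixed p)"
    and "dir_deriv t (dir_deriv t f) p = \<kappa>\<^sup>2 * (quart p + 2 * mixed p)"
proof -
  have p: "p \<in> U" using assms K by auto
  have "Ck_on 4 f U" by (rule Ck_on_mono[OF smooth]) simp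
  note h = heat_equation_derivs[OF U this p heat]
  show "dir_deriv t f p = \<kappa> * lap p + R" using heat[OF p] by (simp add: lap_def)
  show "dir_deriv x (dir_deriv x (dir_deriv t f)) p + dir_deriv y (dir_deriv y (dir_deriv t f)) p
      = \<kappa> * (quart p + 2 * mixed p)"
    "dir_deriv t (dir_deriv t f) p = \<kappa>\<^sup>2 * (quart p + 2 * mixed p)"
    using h by (simp_all add: quart_def mixed_def)
qed

lemma center_expansion:
  "uniform_bigO K 6 (\<lambda>s p. f (p + (\<mu> * s\<^sup>2) *\<^sub>R t)
    - (f p + \<mu> * s\<^sup>2 * (\<kappa> * lap p + R) + (\<mu> * s\<^sup>2)\<^sup>2 / 2 * (\<kappa>\<^sup>2 * (quart p + 2 * mixed p))))"
proof -
  have f3: "Ck_on 3 f U" by (rule Ck_on_mono[OF smooth]) simp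
  have num: "{..<3::nat} = {0,1,2}" "(dir_deriv t ^^ 2) f = dir_deriv t (dir_deriv t f)"
    by (auto simp: numeral_2_eq_2)
  have "uniform_bigO K 6 (\<lambda>s p. f (p + (\<mu> * s\<^sup>2) *\<^sub>R t)
      - (f p + \<mu> * s\<^sup>2 * dir_deriv t f p + (\<mu> * s\<^sup>2)\<^sup>2 / 2 * dir_deriv t (dir_deriv t f) p))"
    using uniform_bigO_Taylor_parabolic[OF U f3 K zero_less_numeral, of 0 0 \<mu> t]
    by (simp add: num fact_numeral add.assoc)
  then show ?thesis
    by (rule iffD1[OF uniform_bigO_cong, rotated]) (simp add: heat_derivs)
qed

lemma cross_expansion:
  "uniform_bigO K 6 (\<lambda>s p. f (p - s *\<^sub>R x + (\<mu> * s\<^sup>2) *\<^sub>R t) + f (p + s *\<^sub>R x + (\<mu> * s\<^sup>2) *\<^sub>R t)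
    + f (p - s *\<^sub>R y + (\<mu> * s\<^sup>2) *\<^sub>R t) + f (p + s *\<^sub>R y + (\<mu> * s\<^sup>2) *\<^sub>R t)
    - (4 * f p + s\<^sup>2 * lap p + s ^ 4 / 12 * quart p
       + \<mu> * s\<^sup>2 * (4 * (\<kappa> * lap p + R) + s\<^sup>2 * (\<kappa> * (quart p + 2 * mixed p)))
       + 2 * (\<mu> * s\<^sup>2)\<^sup>2 * (\<kappa>\<^sup>2 * (quart p + 2 * mixed p))))"
proof -
  have pow: "(dir_deriv v ^^ 2) g = dir_deriv v (dir_deriv v g)"
    "(dir_deriv v ^^ 4) g = dir_deriv v (dir_deriv v (dir_deriv v (dir_deriv v g)))" for v :: 'a and g
    by (simp_all add: eval_nat_numeral)
  show ?thesis
  proof (rule iffD1[OF uniform_bigO_cong uniform_bigO_add[OF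
        symmetric_parabolic_expansion[OF U smooth K, of x \<mu> t] symmetric_parabolic_expansion[OF U smooth K, of y \<mu> t]]])
    fix s p assume p: "p \<in> K"
    show "f (p + s *\<^sub>R x + (\<mu> * s\<^sup>2) *\<^sub>R t) + f (p - s *\<^sub>R x + (\<mu> * s\<^sup>2) *\<^sub>R t) -
        (2 * f p + s\<^sup>2 * (dir_deriv x ^^ 2) f p + s ^ 4 / 12 * (dir_deriv x ^^ 4) f p +
         \<mu> * s\<^sup>2 * (2 * dir_deriv t f p + s\<^sup>2 * (dir_deriv x ^^ 2) (dir_deriv t f) p) +
         (\<mu> * s\<^sup>2)\<^sup>2 * dir_deriv t (dir_deriv t f) p) +
        (f (p + s *\<^sub>R y + (\<mu> * s\<^sup>2) *\<^sub>R t) + f (p - s *\<^sub>R y + (\<mu> * s\<^sup>2) *\<^sub>R t) -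
         (2 * f p + s\<^sup>2 * (dir_deriv y ^^ 2) f p + s ^ 4 / 12 * (dir_deriv y ^^ 4) f p +
          \<mu> * s\<^sup>2 * (2 * dir_deriv t f p + s\<^sup>2 * (dir_deriv y ^^ 2) (dir_deriv t f) p) +
          (\<mu> * s\<^sup>2)\<^sup>2 * dir_deriv t (dir_deriv t f) p))
      = f (p - s *\<^sub>R x + (\<mu> * s\<^sup>2) *\<^sub>R t) + f (p + s *\<^sub>R x + (\<mu> * s\<^sup>2) *\<^sub>R t)
    + f (p - s *\<^sub>R y + (\<mu> * s\<^sup>2) *\<^sub>R t) + f (p + s *\<^sub>R y + (\<mu> * s\<^sup>2) *\<^sub>R t)
    - (4 * f p + s\<^sup>2 * lap p + s ^ 4 / 12 * quart p
       + \<mu> * s\<^sup>2 * (4 * (\<kappa> * lap p + R) + s\<^sup>2 * (\<kappa> * (quart p + 2 * mixed p)))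
       + 2 * (\<mu> * s\<^sup>2)\<^sup>2 * (\<kappa>\<^sup>2 * (quart p + 2 * mixed p)))"
      unfolding heat_derivs[OF p, symmetric]
      unfolding pow lap_def quart_def
      by (simp add: algebra_simps add_divide_distrib)
  qed
qed

lemma diagonal_expansion:
  "uniform_bigO K 6 (\<lambda>s p. f (p - s *\<^sub>R (x + y) + (\<mu> * s\<^sup>2) *\<^sub>R t) + f (p - s *\<^sub>R (x - y) + (\<mu> * s\<^sup>2) *\<^sub>R t)
    + f (p + s *\<^sub>R (x - y) + (\<mu> * s\<^sup>2) *\<^sub>R t) + f (p + s *\<^sub>R (x + y) + (\<mu> * s\<^sup>2) *\<^sub>R t)
    - (4 * f p + 2 * s\<^sup>2 * lap p + s ^ 4 / 12 * (2 * quart p + 12 * mixed p)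
       + \<mu> * s\<^sup>2 * (4 * (\<kappa> * lap p + R) + 2 * s\<^sup>2 * (\<kappa> * (quart p + 2 * mixed p)))
       + 2 * (\<mu> * s\<^sup>2)\<^sup>2 * (\<kappa>\<^sup>2 * (quart p + 2 * mixed p))))"
proof -
  have pow: "(dir_deriv v ^^ 2) g = dir_deriv v (dir_deriv v g)"
    "(dir_deriv v ^^ 4) g = dir_deriv v (dir_deriv v (dir_deriv v (dir_deriv v g)))" for v :: 'a and g
    by (simp_all add: eval_nat_numeral)
  have ck: "Ck_on 2 f U" "Ck_on 4 f U" "Ck_on (Suc 2) f U" by (rule Ck_on_mono[OF smooth], simp)+
  show ?thesis
  proof (rule iffD1[OF uniform_bigO_cong uniform_bigO_add[OF
        symmetric_parabolic_expansion[OF U smooth K, of "x + y" \<mu> t]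
        symmetric_parabolic_expansion[OF U smooth K, of "x - y" \<mu> t]]])
    fix s p assume p: "p \<in> K"
    then have "p \<in> U" using K by auto
    note d = diagonal_dir_derivs[OF U this]
    have eq: "a + b - (2 * g + s2 * p1 + s4 / 12 * q1 + m * (2 * T + s2 * r1) + m\<^sup>2 * S)
      + (c + d - (2 * g + s2 * p2 + s4 / 12 * q2 + m * (2 * T + s2 * r2) + m\<^sup>2 * S))
      = b + d + c + a - (4 * g + 2 * s2 * P + s4 / 12 * Q + m * (4 * T + 2 * s2 * r) + 2 * m\<^sup>2 * S)"
      if "p1 + p2 = 2 * P" "q1 + q2 = Q" "r1 + r2 = 2 * r"
      for a b c d g s2 p1 p2 s4 q1 q2 m T r1 r2 S P Q r :: real
    proof -
      have p2: "p2 = 2 * P - p1" and q2: "q2 = Q - q1" and r2: "r2 = 2 * r - r1"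
        using that by simp_all
      show ?thesis unfolding p2 q2 r2 by (simp add: algebra_simps diff_divide_distrib)
    qed
    show "f (p + s *\<^sub>R (x + y) + (\<mu> * s\<^sup>2) *\<^sub>R t) + f (p - s *\<^sub>R (x + y) + (\<mu> * s\<^sup>2) *\<^sub>R t) -
        (2 * f p + s\<^sup>2 * (dir_deriv (x + y) ^^ 2) f p + s ^ 4 / 12 * (dir_deriv (x + y) ^^ 4) f p +
         \<mu> * s\<^sup>2 * (2 * dir_deriv t f p + s\<^sup>2 * (dir_deriv (x + y) ^^ 2) (dir_deriv t f) p) +
         (\<mu> * s\<^sup>2)\<^sup>2 * dir_deriv t (dir_deriv t f) p) +
        (f (p + s *\<^sub>R (x - y) + (\<mu> * s\<^sup>2) *\<^sub>R t) + f (p - s *\<^sub>R (x - y) + (\<mu> * s\<^sup>2) *\<^sub>R t) -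
         (2 * f p + s\<^sup>2 * (dir_deriv (x - y) ^^ 2) f p + s ^ 4 / 12 * (dir_deriv (x - y) ^^ 4) f p +
          \<mu> * s\<^sup>2 * (2 * dir_deriv t f p + s\<^sup>2 * (dir_deriv (x - y) ^^ 2) (dir_deriv t f) p) +
          (\<mu> * s\<^sup>2)\<^sup>2 * dir_deriv t (dir_deriv t f) p))
      = f (p - s *\<^sub>R (x + y) + (\<mu> * s\<^sup>2) *\<^sub>R t) + f (p - s *\<^sub>R (x - y) + (\<mu> * s\<^sup>2) *\<^sub>R t)
    + f (p + s *\<^sub>R (x - y) + (\<mu> * s\<^sup>2) *\<^sub>R t) + f (p + s *\<^sub>R (x + y) + (\<mu> * s\<^sup>2) *\<^sub>R t)
    - (4 * f p + 2 * s\<^sup>2 * lap p + s ^ 4 / 12 * (2 * quart p + 12 * mixed p)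
       + \<mu> * s\<^sup>2 * (4 * (\<kappa> * lap p + R) + 2 * s\<^sup>2 * (\<kappa> * (quart p + 2 * mixed p)))
       + 2 * (\<mu> * s\<^sup>2)\<^sup>2 * (\<kappa>\<^sup>2 * (quart p + 2 * mixed p)))"
      unfolding heat_derivs[OF p, symmetric] pow
      by (rule eq) (use d ck Ck_on_dir_deriv[OF ck(3)] in \<open>auto simp: lap_def quart_def mixed_def simp del: Ck_on.simps\<close>)
  qed
qed

end

section \<open>The order conditions\<close>

text \<open>
  These three relations are all that the choice of the parameters is for. The first makes the diffusion
  coefficient of the scheme equal to \<open>\<kappa>\<close>. The other two cancel the two combinations of fourth derivatives
  in the truncation error: the second one makes its leading part isotropic, that is a multiple of the
  squared Laplacian, and the third one removes that multiple.
\<close>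

lemma slfd_parameter_relations:
  fixes w0 s2 s4 s5 \<epsilon> :: real
  assumes "s5 \<noteq> 0" "s5 \<noteq> 2" "s5 - 6 \<noteq> 0" "2 * s5 - 36 * \<epsilon> + 24 * \<epsilon> * s5 + \<epsilon> * s5\<^sup>2 \<noteq> 0"
    and w0: "w0 = (s5 + (6 * s5 - 12) * \<epsilon>) / s5"
    and s2: "s2 = (6 * s5 - 12) / (s5 - 6)"
    and s4: "s4 = (12 * \<epsilon> * s5\<^sup>2 - 24 * \<epsilon> * s5 + 2 * s5\<^sup>2)
              / (2 * s5 - 36 * \<epsilon> + 24 * \<epsilon> * s5 + \<epsilon> * s5\<^sup>2)"
  shows "4 * s2 * \<epsilon> = (1 - w0) * (2 - s2)"
    and "6 * (s2 + s5 - 2) = s2 * s5"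
    and "\<epsilon> * (s2 * (4 * s4 * s5 + 2 * s2 * s5 + 2 * s2 * s4 - 7 * s2 * s4 * s5))
      + (- s4 * s5 - s2 * s5 - 2 * s2 * s4 + 4 * s2 * s4 * s5 + s2\<^sup>2 * s5 / 2 + s2\<^sup>2 * s4 - 3 / 2 * s2\<^sup>2 * s4 * s5
         + w0 * s4 * (s5 + s2 - 3 * s2 * s5 - s2\<^sup>2 / 2 + 3 / 2 * s2\<^sup>2 * s5))
      = s2\<^sup>2 * s4 * s5 / 6"
proof -
  show "4 * s2 * \<epsilon> = (1 - w0) * (2 - s2)" "6 * (s2 + s5 - 2) = s2 * s5"
    using assms(1,3) unfolding w0 s2 by (simp_all add: field_simps)
  \<comment> \<open>Keeping numerator and denominators opaque while clearing fractions keeps the polynomials small.\<close>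
  define N D q where "N = 12 * \<epsilon> * s5\<^sup>2 - 24 * \<epsilon> * s5 + 2 * s5\<^sup>2"
    and "D = 2 * s5 - 36 * \<epsilon> + 24 * \<epsilon> * s5 + \<epsilon> * s5\<^sup>2" and "q = s5 - 6"
  have "D \<noteq> 0" "q \<noteq> 0" using assms by (simp_all add: D_def q_def)
  then show "\<epsilon> * (s2 * (4 * s4 * s5 + 2 * s2 * s5 + 2 * s2 * s4 - 7 * s2 * s4 * s5))
      + (- s4 * s5 - s2 * s5 - 2 * s2 * s4 + 4 * s2 * s4 * s5 + s2\<^sup>2 * s5 / 2 + s2\<^sup>2 * s4 - 3 / 2 * s2\<^sup>2 * s4 * s5
         + w0 * s4 * (s5 + s2 - 3 * s2 * s5 - s2\<^sup>2 / 2 + 3 / 2 * s2\<^sup>2 * s5))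
      = s2\<^sup>2 * s4 * s5 / 6"
    using assms(1) unfolding w0 s2 s4 N_def[symmetric] D_def[symmetric] q_def[symmetric]
    by (simp add: divide_simps power2_eq_square)
      (simp add: N_def D_def q_def power2_eq_square algebra_simps)
qed

text \<open>
  Scaled by the mesh, this is the Taylor polynomial of parabolic order 5 of a solution, averaged over
  the symmetries of the stencil: \<open>g\<close>, \<open>h\<close>, \<open>q\<close>, \<open>z\<close> stand for \<open>\<phi>\<close>, \<open>\<Delta>x\<^sup>2\<close> times its Laplacian, and \<open>\<Delta>x\<^sup>4\<close> times
  the two combinations of fourth derivatives; \<open>\<rho>\<close> is \<open>\<Delta>t R\<close>. The time derivatives have been eliminated
  by the equation.
\<close>

definition heat_polynomial :: "real \<Rightarrow> real \<Rightarrow> real \<Rightarrow> real \<Rightarrow> real \<Rightarrow> real \<Rightarrow> int \<Rightarrow> int \<times> int \<Rightarrow> real" where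
  "heat_polynomial \<epsilon> g h \<rho> q z n = (\<lambda>(i, j). let n = of_int n; i = of_int i; j = of_int j in
     g + n * (\<epsilon> * h + \<rho>) + n\<^sup>2 * \<epsilon>\<^sup>2 / 2 * (q + 2 * z) + (i\<^sup>2 + j\<^sup>2) * h / 4
     + n * (i\<^sup>2 + j\<^sup>2) * \<epsilon> / 4 * (q + 2 * z) + (i ^ 4 + j ^ 4) * q / 48 + i\<^sup>2 * j\<^sup>2 * z / 4)"

text \<open>
  By linearity the defect is a combination of \<open>\<phi>\<close>, \<open>\<phi>\<^sub>t\<close>, the Laplacian and the fourth derivatives, whose factors
  are moments of the coefficients of the scheme. The factor of \<open>\<phi>\<close> vanishes for all parameters, and that
  of \<open>\<phi>\<^sub>t\<close> is \<open>\<delta>\<close>, which balances the source and turns the condition on the Laplacian into the first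
  relation. The other two relations are the conditions on the fourth derivatives.
\<close>

lemma slfd_exact_heat_polynomial:
  fixes w0 s2 s4 s5 \<epsilon> :: real
  assumes o1: "4 * s2 * \<epsilon> = (1 - w0) * (2 - s2)"
    and o2: "6 * (s2 + s5 - 2) = s2 * s5"
    and o3: "\<epsilon> * (s2 * (4 * s4 * s5 + 2 * s2 * s5 + 2 * s2 * s4 - 7 * s2 * s4 * s5))
      + (- s4 * s5 - s2 * s5 - 2 * s2 * s4 + 4 * s2 * s4 * s5 + s2\<^sup>2 * s5 / 2 + s2\<^sup>2 * s4 - 3 / 2 * s2\<^sup>2 * s4 * s5
         + w0 * s4 * (s5 + s2 - 3 * s2 * s5 - s2\<^sup>2 / 2 + 3 / 2 * s2\<^sup>2 * s5))
      = s2\<^sup>2 * s4 * s5 / 6"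
  shows "slfd_rhs w0 s2 s4 s5 R dt (heat_polynomial \<epsilon> g h (dt * R) q z) 0 (0, 0)
    = heat_polynomial \<epsilon> g h (dt * R) q z 1 (0, 0)"
proof -
  \<comment> \<open>The defects of the three relations; the defect of the scheme will be a combination of them.\<close>
  define A where "A = 4 * s2 * \<epsilon> - (1 - w0) * (2 - s2)"
  define B where "B = 6 * (s2 + s5 - 2) - s2 * s5"
  define M where "M = s2 * (4 * s4 * s5 + 2 * s2 * s5 + 2 * s2 * s4 - 7 * s2 * s4 * s5)"
  define D where "D = - s4 * s5 - s2 * s5 - 2 * s2 * s4 + 4 * s2 * s4 * s5 + s2\<^sup>2 * s5 / 2 + s2\<^sup>2 * s4
    - 3 / 2 * s2\<^sup>2 * s4 * s5 + w0 * s4 * (s5 + s2 - 3 * s2 * s5 - s2\<^sup>2 / 2 + 3 / 2 * s2\<^sup>2 * s5)"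
  define C where "C = \<epsilon> * M + D - s2\<^sup>2 * s4 * s5 / 6"
  \<comment> \<open>\<open>S1\<close>, \<open>bg\<close>: moments of \<open>(i\<^sup>2 + j\<^sup>2) / 4\<close> and \<open>i\<^sup>2 j\<^sup>2 / 4\<close>; \<open>Ez\<close>: factor of \<open>z\<close> in the defect.\<close>
  define bg where "bg = (s2 + s5 - 2) * (2 - s2) * s4 * (1 - w0) / 4"
  define S1 where "S1 = s2 * s4 * s5 * (1 - w0) * (2 - s2) / 4"
  define Ez where "Ez = \<epsilon> * (C + s2\<^sup>2 * s4 * s5 / 6) - bg"
  have "A = 0" "B = 0" unfolding A_def B_def o1 o2 by simp_all
  moreover have "C = 0" unfolding C_def M_def D_def o3 by simp
  ultimately have zero: "A = 0" "B = 0" "C = 0" .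
  have 1: "\<epsilon> * (s2\<^sup>2 * s4 * s5) - S1 = s2 * s4 * s5 / 4 * A"
    by (simp add: S1_def A_def power2_eq_square field_simps)
  have 2: "Ez = \<epsilon> * C + s2 * s4 * s5 / 24 * A - (2 - s2) * s4 * (1 - w0) / 24 * B"
    by (simp add: Ez_def bg_def A_def B_def power2_eq_square field_simps)
  have 3: "bg - S1 / 6 = (2 - s2) * s4 * (1 - w0) / 24 * B"
    by (simp add: S1_def bg_def B_def power2_eq_square field_simps)
  define \<alpha>1 where "\<alpha>1 = (w0 - 1) * s4 + 1"
  define \<alpha>2 where "\<alpha>2 = 1 - s5 / 4 - s2 / 2 - s4 * w0 / 4"
  define \<beta>1 where "\<beta>1 = (s4 * w0 + s5 - 2) * (1 - s2)"
  define \<beta>2 where "\<beta>2 = ((s5 + 2 * s2 - 4) * (1 - s4) + w0 * s4 * (s5 + 2 * s2 - 3)) / 4"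
  define \<beta>3 where "\<beta>3 = (2 - s2 - s4 * w0) * (s2 + s5 - 2) / 4"
  define \<gamma>1 where "\<gamma>1 = s4 * w0 * (s2 - 1) * (s5 - 1) + (1 - s4) * (s5 - 2) * (s2 - 1)"
  define \<gamma>2 where "\<gamma>2 = (s2 - 1) * (s4 * w0 * (3 - s2 - 2 * s5) + (2 * s2 + 3 * s5 - s2 * s5 - 4)) / 4"
  define \<gamma>3 where "\<gamma>3 = (w0 * s4 * (s2 - 1) * (s2 + s5 - 2) + (1 - s4) * (s2 - 2) * (s2 + s5 - 2)) / 4"
  define \<zeta>1 where "\<zeta>1 = (w0 * s4 - 1) * (1 - s5) * (s2 - 1)\<^sup>2"
  define \<zeta>2 where "\<zeta>2 = (s4 * w0 * (s2 - 1)\<^sup>2 * (s5 - 1)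
    + (1 - s4) * (1 - s2) * (2 * s2 + 3 * s5 - s2 * s5 - 4)) / 4"
  define \<eta> where "\<eta> = (1 - s2)\<^sup>2 * (1 - s4) * (1 - s5)"
  note coeff_defs = \<alpha>1_def \<alpha>2_def \<beta>1_def \<beta>2_def \<beta>3_def \<gamma>1_def \<gamma>2_def \<gamma>3_def \<zeta>1_def \<zeta>2_def \<eta>_def
  have rhs: "slfd_rhs w0 s2 s4 s5 R dt u 0 (0, 0) =
       \<alpha>1 * u 0 (0, 0) + \<alpha>2 * Sigma1 (u 0) (0, 0)
       + \<beta>1 * u (-1) (0, 0) + \<beta>2 * Sigma1 (u (-1)) (0, 0) + \<beta>3 * Sigma2 (u (-1)) (0, 0)
       + \<gamma>1 * u (-2) (0, 0) + \<gamma>2 * Sigma1 (u (-2)) (0, 0) + \<gamma>3 * Sigma2 (u (-2)) (0, 0)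
       + \<zeta>1 * u (-3) (0, 0) + \<zeta>2 * Sigma1 (u (-3)) (0, 0) + \<eta> * u (-4) (0, 0)
       + dt * (s2\<^sup>2 * s4 * s5) * R" for u
    unfolding slfd_rhs_def Let_def coeff_defs slfd_delta_def by simp
  have moments:
    "1 - (\<alpha>1 + 4 * \<alpha>2 + \<beta>1 + 4 * \<beta>2 + 4 * \<beta>3 + \<gamma>1 + 4 * \<gamma>2 + 4 * \<gamma>3 + \<zeta>1 + 4 * \<zeta>2 + \<eta>) = 0"
    "1 + (\<beta>1 + 4 * \<beta>2 + 4 * \<beta>3) + 2 * (\<gamma>1 + 4 * \<gamma>2 + 4 * \<gamma>3) + 3 * (\<zeta>1 + 4 * \<zeta>2) + 4 * \<eta> = s2\<^sup>2 * s4 * s5"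
    "1 - ((\<beta>1 + 4 * \<beta>2 + 4 * \<beta>3) + 4 * (\<gamma>1 + 4 * \<gamma>2 + 4 * \<gamma>3) + 9 * (\<zeta>1 + 4 * \<zeta>2) + 16 * \<eta>) = M"
    "\<alpha>2 + \<beta>2 + 2 * \<beta>3 + \<gamma>2 + 2 * \<gamma>3 + \<zeta>2 = S1"
    "\<beta>2 + 2 * \<beta>3 + 2 * (\<gamma>2 + 2 * \<gamma>3) + 3 * \<zeta>2 = D / 2"
    "\<beta>3 + \<gamma>3 = bg"
    unfolding coeff_defs M_def S1_def D_def bg_def
    by (simp_all add: power2_eq_square field_simps)
  \<comment> \<open>\<open>k\<close> and \<open>m\<close> are the scaled \<open>\<phi>\<^sub>t\<close> and time derivative of the Laplacian.\<close>
  define k m where "k = \<epsilon> * h + dt * R" and "m = \<epsilon> * (q + 2 * z)"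
  define P where "P n = g + n * k + n\<^sup>2 * (\<epsilon> * m) / 2" for n :: real
  have poly: "heat_polynomial \<epsilon> g h (dt * R) q z n (0, 0) = P n"
    "Sigma1 (heat_polynomial \<epsilon> g h (dt * R) q z n) (0, 0) = 4 * P n + h + n * m + q / 12"
    "Sigma2 (heat_polynomial \<epsilon> g h (dt * R) q z n) (0, 0) = 4 * P n + 2 * h + 2 * n * m + q / 6 + z" for n
    by (simp_all add: heat_polynomial_def Sigma1_def Sigma2_def Let_def P_def k_def m_def power2_eq_square field_simps)
  have "heat_polynomial \<epsilon> g h (dt * R) q z 1 (0, 0)
      - slfd_rhs w0 s2 s4 s5 R dt (heat_polynomial \<epsilon> g h (dt * R) q z) 0 (0, 0)
    = g * (1 - (\<alpha>1 + 4 * \<alpha>2 + \<beta>1 + 4 * \<beta>2 + 4 * \<beta>3 + \<gamma>1 + 4 * \<gamma>2 + 4 * \<gamma>3 + \<zeta>1 + 4 * \<zeta>2 + \<eta>))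
      + k * (1 + (\<beta>1 + 4 * \<beta>2 + 4 * \<beta>3) + 2 * (\<gamma>1 + 4 * \<gamma>2 + 4 * \<gamma>3) + 3 * (\<zeta>1 + 4 * \<zeta>2) + 4 * \<eta>)
      + \<epsilon> * m / 2 * (1 - ((\<beta>1 + 4 * \<beta>2 + 4 * \<beta>3) + 4 * (\<gamma>1 + 4 * \<gamma>2 + 4 * \<gamma>3) + 9 * (\<zeta>1 + 4 * \<zeta>2) + 16 * \<eta>))
      - (h + q / 12) * (\<alpha>2 + \<beta>2 + 2 * \<beta>3 + \<gamma>2 + 2 * \<gamma>3 + \<zeta>2)
      + m * (\<beta>2 + 2 * \<beta>3 + 2 * (\<gamma>2 + 2 * \<gamma>3) + 3 * \<zeta>2)
      - z * (\<beta>3 + \<gamma>3) - dt * (s2\<^sup>2 * s4 * s5) * R"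
    unfolding rhs poly P_def by (simp add: algebra_simps add_divide_distrib)
  also have "\<dots> = h * (\<epsilon> * (s2\<^sup>2 * s4 * s5) - S1) + z * Ez + q * (Ez / 2 + (bg - S1 / 6) / 2)"
    unfolding moments k_def m_def Ez_def C_def
    by (simp add: algebra_simps add_divide_distrib diff_divide_distrib)
  also have "\<dots> = 0" unfolding 1 2 3 by (simp add: zero)
  finally show ?thesis by simp
qed

section \<open>The truncation error of the scheme\<close>

definition (in parabolic_stencil) stencil_values :: "real \<Rightarrow> real \<Rightarrow> 'a \<Rightarrow> int \<Rightarrow> int \<times> int \<Rightarrow> real" where
  "stencil_values \<nu> s p m = (\<lambda>(i, j).
     f (p + (of_int i * s) *\<^sub>R x + (of_int j * s) *\<^sub>R y + (of_int m * \<nu> * s\<^sup>2) *\<^sub>R t))"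

text \<open>
  Opaque coefficients keep the terms small where only the affine shape of the scheme is used.
\<close>

lemma slfd_rhs_linear_form:
  obtains \<alpha>1 \<alpha>2 \<beta>1 \<beta>2 \<beta>3 \<gamma>1 \<gamma>2 \<gamma>3 \<zeta>1 \<zeta>2 \<eta> where "\<And>R dt u n r. slfd_rhs w0 s2 s4 s5 R dt u n r =
       \<alpha>1 * u n r + \<alpha>2 * Sigma1 (u n) r
       + \<beta>1 * u (n - 1) r + \<beta>2 * Sigma1 (u (n - 1)) r + \<beta>3 * Sigma2 (u (n - 1)) r
       + \<gamma>1 * u (n - 2) r + \<gamma>2 * Sigma1 (u (n - 2)) r + \<gamma>3 * Sigma2 (u (n - 2)) r
       + \<zeta>1 * u (n - 3) r + \<zeta>2 * Sigma1 (u (n - 3)) r + \<eta> * u (n - 4) r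
       + dt * slfd_delta s2 s4 s5 * R"
  by (rule that, unfold slfd_rhs_def Let_def, rule refl)

text \<open>
  On the centre, the axis sum and the diagonal sum at each level, the values of the solution differ by
  \<open>O(s\<^sup>6)\<close> from those of the heat polynomial, for which the scheme is exact.
\<close>

lemma (in parabolic_stencil) slfd_local_error:
  assumes \<epsilon>: "\<epsilon> = \<nu> * \<kappa>"
    and exact: "\<And>g h dt q z. slfd_rhs w0 s2 s4 s5 R dt (heat_polynomial \<epsilon> g h (dt * R) q z) 0 (0, 0)
      = heat_polynomial \<epsilon> g h (dt * R) q z 1 (0, 0)"
  shows "uniform_bigO K 6 (\<lambda>s p. stencil_values \<nu> s p 1 (0, 0)
    - slfd_rhs w0 s2 s4 s5 R (\<nu> * s\<^sup>2) (stencil_values \<nu> s p) 0 (0, 0))"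
proof -
  define v where "v s p = heat_polynomial \<epsilon> (f p) (s\<^sup>2 * lap p) (\<nu> * s\<^sup>2 * R) (s ^ 4 * quart p) (s ^ 4 * mixed p)" for s p
  have E0: "uniform_bigO K 6 (\<lambda>s p. stencil_values \<nu> s p m (0, 0) - v s p m (0, 0))" for m
    by (rule iffD1[OF uniform_bigO_cong center_expansion[of "of_int m * \<nu>"]])
      (simp add: stencil_values_def v_def heat_polynomial_def Let_def \<epsilon> power2_eq_square power4_eq_xxxx algebra_simps)
  have E1: "uniform_bigO K 6 (\<lambda>s p. Sigma1 (stencil_values \<nu> s p m) (0, 0) - Sigma1 (v s p m) (0, 0))" for m
    by (rule iffD1[OF uniform_bigO_cong cross_expansion[of "of_int m * \<nu>"]])
      (simp add: Sigma1_def stencil_values_def v_def heat_polynomial_def Let_def \<epsilon> power2_eq_square power4_eq_xxxx algebra_simps)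
  have E2: "uniform_bigO K 6 (\<lambda>s p. Sigma2 (stencil_values \<nu> s p m) (0, 0) - Sigma2 (v s p m) (0, 0))" for m
    by (rule iffD1[OF uniform_bigO_cong diagonal_expansion[of "of_int m * \<nu>"]])
      (simp add: Sigma2_def stencil_values_def v_def heat_polynomial_def Let_def \<epsilon> power2_eq_square power4_eq_xxxx algebra_simps)
  obtain \<alpha>1 \<alpha>2 \<beta>1 \<beta>2 \<beta>3 \<gamma>1 \<gamma>2 \<gamma>3 \<zeta>1 \<zeta>2 \<eta> where rhs: "\<And>dt u. slfd_rhs w0 s2 s4 s5 R dt u 0 (0, 0) =
       \<alpha>1 * u 0 (0, 0) + \<alpha>2 * Sigma1 (u 0) (0, 0)
       + \<beta>1 * u (-1) (0, 0) + \<beta>2 * Sigma1 (u (-1)) (0, 0) + \<beta>3 * Sigma2 (u (-1)) (0, 0)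
       + \<gamma>1 * u (-2) (0, 0) + \<gamma>2 * Sigma1 (u (-2)) (0, 0) + \<gamma>3 * Sigma2 (u (-2)) (0, 0)
       + \<zeta>1 * u (-3) (0, 0) + \<zeta>2 * Sigma1 (u (-3)) (0, 0) + \<eta> * u (-4) (0, 0)
       + dt * slfd_delta s2 s4 s5 * R"
    by (rule slfd_rhs_linear_form[of w0 s2 s4 s5]) auto
  have vrhs: "v s p 1 (0, 0) = slfd_rhs w0 s2 s4 s5 R (\<nu> * s\<^sup>2) (v s p) 0 (0, 0)" for s p
    unfolding v_def by (rule exact[symmetric])
  note terms = uniform_bigO_cmult[OF E0] uniform_bigO_cmult[OF E1] uniform_bigO_cmult[OF E2]
  have "uniform_bigO K 6 (\<lambda>s p. (stencil_values \<nu> s p 1 (0, 0) - v s p 1 (0, 0)) -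
     (\<alpha>1 * (stencil_values \<nu> s p 0 (0, 0) - v s p 0 (0, 0))
      + \<alpha>2 * (Sigma1 (stencil_values \<nu> s p 0) (0, 0) - Sigma1 (v s p 0) (0, 0))
      + \<beta>1 * (stencil_values \<nu> s p (-1) (0, 0) - v s p (-1) (0, 0))
      + \<beta>2 * (Sigma1 (stencil_values \<nu> s p (-1)) (0, 0) - Sigma1 (v s p (-1)) (0, 0))
      + \<beta>3 * (Sigma2 (stencil_values \<nu> s p (-1)) (0, 0) - Sigma2 (v s p (-1)) (0, 0))
      + \<gamma>1 * (stencil_values \<nu> s p (-2) (0, 0) - v s p (-2) (0, 0))
      + \<gamma>2 * (Sigma1 (stencil_values \<nu> s p (-2)) (0, 0) - Sigma1 (v s p (-2)) (0, 0))
      + \<gamma>3 * (Sigma2 (stencil_values \<nu> s p (-2)) (0, 0) - Sigma2 (v s p (-2)) (0, 0))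
      + \<zeta>1 * (stencil_values \<nu> s p (-3) (0, 0) - v s p (-3) (0, 0))
      + \<zeta>2 * (Sigma1 (stencil_values \<nu> s p (-3)) (0, 0) - Sigma1 (v s p (-3)) (0, 0))
      + \<eta> * (stencil_values \<nu> s p (-4) (0, 0) - v s p (-4) (0, 0))))"
    by (intro uniform_bigO_diff uniform_bigO_add E0 terms)
  then show ?thesis
    by (rule iffD1[OF uniform_bigO_cong, rotated]) (simp only: vrhs, simp add: rhs algebra_simps)
qed

lemma deriv_along_line:
  assumes "f differentiable (at (p + r *\<^sub>R v))"
  shows "deriv (\<lambda>r. f (p + r *\<^sub>R v)) r = dir_deriv v f (p + r *\<^sub>R v)"
  by (rule DERIV_imp_deriv[OF DERIV_along_line[OF assms]])

lemma deriv2_along_line: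
  fixes f :: "'a::real_normed_vector \<Rightarrow> real"
  assumes U: "open U" and f: "Ck_on 2 f U" and p: "p + r *\<^sub>R v \<in> U"
  shows "(deriv ^^ 2) (\<lambda>r. f (p + r *\<^sub>R v)) r = dir_deriv v (dir_deriv v f) (p + r *\<^sub>R v)"
proof -
  have f': "Ck_on (Suc 1) f U" using f by (simp add: numeral_2_eq_2)
  have "isCont (\<lambda>r. p + r *\<^sub>R v) r" by (intro continuous_intros)
  then have "eventually (\<lambda>r. p + r *\<^sub>R v \<in> U) (nhds r)"
    using U p by (simp add: continuous_at_open eventually_nhds)
  then have "eventually (\<lambda>r. deriv (\<lambda>r. f (p + r *\<^sub>R v)) r = dir_deriv v f (p + r *\<^sub>R v)) (nhds r)"
    by eventually_elim (use f' in \<open>auto intro: deriv_along_line\<close>)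
  then have "deriv (deriv (\<lambda>r. f (p + r *\<^sub>R v))) r = deriv (\<lambda>r. dir_deriv v f (p + r *\<^sub>R v)) r"
    by (rule deriv_cong_ev) simp
  also have "\<dots> = dir_deriv v (dir_deriv v f) (p + r *\<^sub>R v)"
    using Ck_on_dir_deriv[OF f', of v] p by (intro deriv_along_line) simp
  finally show ?thesis by (simp add: numeral_2_eq_2)
qed

lemma diffusion_solution_dir_deriv:
  fixes \<phi> :: "real \<times> real \<times> real \<Rightarrow> real"
  assumes U: "open U" and \<phi>: "Ck_on 2 \<phi> U" and sol: "diffusion_solution_on U \<kappa> R \<phi>" and p: "p \<in> U"
  shows "dir_deriv (0, 0, 1) \<phi> p = \<kappa> * (dir_deriv (1, 0, 0) (dir_deriv (1, 0, 0) \<phi>) p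
    + dir_deriv (0, 1, 0) (dir_deriv (0, 1, 0) \<phi>) p) + R"
proof -
  obtain x y t where xyt: "p = (x, y, t)" by (cases p)
  have "\<phi> differentiable (at p)" using \<phi> p by (simp add: numeral_2_eq_2)
  then have "deriv (\<lambda>\<tau>. \<phi> (x, y, \<tau>)) t = dir_deriv (0, 0, 1) \<phi> p"
    using deriv_along_line[of \<phi> "(x, y, 0)" t "(0, 0, 1)"] by (simp add: xyt)
  moreover have "(deriv ^^ 2) (\<lambda>\<xi>. \<phi> (\<xi>, y, t)) x = dir_deriv (1, 0, 0) (dir_deriv (1, 0, 0) \<phi>) p"
    using deriv2_along_line[OF U \<phi>, of "(0, y, t)" x "(1, 0, 0)"] p by (simp add: xyt)
  moreover have "(deriv ^^ 2) (\<lambda>\<upsilon>. \<phi> (x, \<upsilon>, t)) y = dir_deriv (0, 1, 0) (dir_deriv (0, 1, 0) \<phi>) p"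
    using deriv2_along_line[OF U \<phi>, of "(x, 0, t)" y "(0, 1, 0)"] p by (simp add: xyt)
  ultimately show ?thesis
    using sol p by (simp add: diffusion_solution_on_def xyt)
qed

text \<open>
  The local error \<open>O(\<Delta>x\<^sup>6)\<close> is divided by \<open>\<Delta>t \<delta>\<close>, a multiple of \<open>\<Delta>x\<^sup>2\<close>.
\<close>

lemma slfd_accuracy_fourth_order:
  assumes \<kappa>: "\<kappa> > 0" and \<epsilon>: "\<epsilon> > 0" and \<delta>: "slfd_delta s2 s4 s5 > 0"
    and exact: "\<And>g h dt q z. slfd_rhs w0 s2 s4 s5 R dt (heat_polynomial \<epsilon> g h (dt * R) q z) 0 (0, 0)
      = heat_polynomial \<epsilon> g h (dt * R) q z 1 (0, 0)"
  shows "slfd_accuracy \<kappa> R \<epsilon> w0 s2 s4 s5 (\<lambda>dx dt. dx ^ 4)"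
  unfolding slfd_accuracy_def
proof (intro allI impI)
  fix U K :: "(real \<times> real \<times> real) set" and \<phi>
  assume U: "open U" and \<phi>: "Ck_on 6 \<phi> U" and sol: "diffusion_solution_on U \<kappa> R \<phi>"
    and K: "compact K" "K \<subseteq> U"
  have \<phi>2: "Ck_on 2 \<phi> U" by (rule Ck_on_mono[OF \<phi>]) simp
  interpret parabolic_stencil U K \<phi> "(1, 0, 0)" "(0, 1, 0)" "(0, 0, 1)" \<kappa> R
    by unfold_locales (fact U \<phi> K diffusion_solution_dir_deriv[OF U \<phi>2 sol])+
  define \<nu> where "\<nu> = \<epsilon> / \<kappa>"
  have \<nu>: "\<epsilon> = \<nu> * \<kappa>" "\<nu> > 0" using \<kappa> \<epsilon> by (simp_all add: \<nu>_def)
  obtain C where C: "\<forall>\<^sub>F s in at_right 0. \<forall>p\<in>K. \<bar>stencil_values \<nu> s p 1 (0, 0)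
    - slfd_rhs w0 s2 s4 s5 R (\<nu> * s\<^sup>2) (stencil_values \<nu> s p) 0 (0, 0)\<bar> \<le> C * s ^ 6"
    using slfd_local_error[OF \<nu>(1) exact] unfolding uniform_bigO_def by blast
  have shift: "grid_values s (\<nu> * s\<^sup>2) \<phi> (n + m) (i + a, j + b)
      = stencil_values \<nu> s (grid_point s (\<nu> * s\<^sup>2) n (i, j)) m (a, b)" for s n m i a j b
    by (simp add: grid_values_def grid_point_def stencil_values_def algebra_simps)
  have "\<forall>\<^sub>F s in at_right (0::real). s > 0" by (simp add: eventually_at_right_less)
  with C have "\<forall>\<^sub>F s in at_right 0. let dt = \<epsilon> * s\<^sup>2 / \<kappa> in
      \<forall>n r. grid_point s dt n r \<in> K \<longrightarrow>
        \<bar>slfd_truncation_error w0 s2 s4 s5 R s dt \<phi> n r\<bar> \<le> (C / (\<nu> * slfd_delta s2 s4 s5)) * s ^ 4"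
  proof eventually_elim
    case (elim s)
    have dt: "\<epsilon> * s\<^sup>2 / \<kappa> = \<nu> * s\<^sup>2" by (simp add: \<nu>_def)
    show ?case unfolding Let_def dt
    proof (intro allI impI)
      fix n and r :: "int \<times> int"
      assume inK: "grid_point s (\<nu> * s\<^sup>2) n r \<in> K"
      obtain i j where r: "r = (i, j)" by (cases r)
      let ?u = "grid_values s (\<nu> * s\<^sup>2) \<phi>" and ?v = "stencil_values \<nu> s (grid_point s (\<nu> * s\<^sup>2) n (i, j))"
      have "?u (n + 1) (i, j) = ?v 1 (0, 0)" using shift[of s n 1 i 0 j 0] by simp
      moreover have "slfd_rhs w0 s2 s4 s5 R (\<nu> * s\<^sup>2) ?u n (i, j) = slfd_rhs w0 s2 s4 s5 R (\<nu> * s\<^sup>2) ?v 0 (0, 0)"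
        unfolding slfd_rhs_def Let_def Sigma1_def Sigma2_def by (simp flip: shift)
      ultimately have "\<bar>slfd_truncation_error w0 s2 s4 s5 R s (\<nu> * s\<^sup>2) \<phi> n r\<bar>
          = \<bar>?v 1 (0, 0) - slfd_rhs w0 s2 s4 s5 R (\<nu> * s\<^sup>2) ?v 0 (0, 0)\<bar> / (\<nu> * s\<^sup>2 * slfd_delta s2 s4 s5)"
        using \<nu> \<delta> by (simp add: slfd_truncation_error_def Let_def r abs_mult)
      also have "\<dots> \<le> C * s ^ 6 / (\<nu> * s\<^sup>2 * slfd_delta s2 s4 s5)"
        using elim inK \<nu> \<delta> by (intro divide_right_mono) (auto simp: r)
      also have "\<dots> = (C / (\<nu> * slfd_delta s2 s4 s5)) * s ^ 4"
      proof -
        have "C * (a * b) / (\<nu> * b * d) = C / (\<nu> * d) * a" if "b \<noteq> 0" for a b d :: real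
          using that by simp
        from this[of "s\<^sup>2" "s ^ 4"] show ?thesis using elim(2) by (simp flip: power_add)
      qed
      finally show "\<bar>slfd_truncation_error w0 s2 s4 s5 R s (\<nu> * s\<^sup>2) \<phi> n r\<bar> \<le> (C / (\<nu> * slfd_delta s2 s4 s5)) * s ^ 4" .
    qed
  qed
  then show "\<exists>C. \<forall>\<^sub>F dx in at_right 0. let dt = \<epsilon> * dx\<^sup>2 / \<kappa> in
      \<forall>n r. grid_point dx dt n r \<in> K \<longrightarrow>
        \<bar>slfd_truncation_error w0 s2 s4 s5 R dx dt \<phi> n r\<bar> \<le> C * dx ^ 4" by blast
qed

lemma slfd_accuracy_mono:
  assumes "slfd_accuracy \<kappa> R \<epsilon> w0 s2 s4 s5 g"
    and "\<And>dx dt. dx > 0 \<Longrightarrow> dt \<ge> 0 \<Longrightarrow> 0 \<le> g dx dt \<and> g dx dt \<le> g' dx dt" and "\<epsilon> / \<kappa> \<ge> 0"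
  shows "slfd_accuracy \<kappa> R \<epsilon> w0 s2 s4 s5 g'"
  unfolding slfd_accuracy_def
proof (intro allI impI)
  fix U K :: "(real \<times> real \<times> real) set" and \<phi>
  assume a: "open U" "Ck_on 6 \<phi> U" "diffusion_solution_on U \<kappa> R \<phi>" "compact K" "K \<subseteq> U"
  then obtain C where "\<forall>\<^sub>F dx in at_right 0. let dt = \<epsilon> * dx\<^sup>2 / \<kappa> in
      \<forall>n r. grid_point dx dt n r \<in> K \<longrightarrow>
        \<bar>slfd_truncation_error w0 s2 s4 s5 R dx dt \<phi> n r\<bar> \<le> C * g dx dt"
    using assms(1) unfolding slfd_accuracy_def by blast
  moreover have "\<forall>\<^sub>F s in at_right (0::real). s > 0" by (simp add: eventually_at_right_less)
  ultimately have "\<forall>\<^sub>F dx in at_right 0. let dt = \<epsilon> * dx\<^sup>2 / \<kappa> in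
      \<forall>n r. grid_point dx dt n r \<in> K \<longrightarrow>
        \<bar>slfd_truncation_error w0 s2 s4 s5 R dx dt \<phi> n r\<bar> \<le> \<bar>C\<bar> * g' dx dt"
  proof eventually_elim
    case (elim dx)
    define dt where "dt = \<epsilon> * dx\<^sup>2 / \<kappa>"
    have "dt \<ge> 0" using mult_nonneg_nonneg[OF assms(3), of "dx\<^sup>2"] by (simp add: dt_def)
    with elim(2) assms(2)[of dx dt] have "0 \<le> g dx dt" "g dx dt \<le> g' dx dt" by auto
    then have "C * g dx dt \<le> \<bar>C\<bar> * g' dx dt" by (intro mult_mono) auto
    with elim(1) show ?case unfolding Let_def dt_def[symmetric] by (blast intro: order_trans)
  qed
  then show "\<exists>C. \<forall>\<^sub>F dx in at_right 0. let dt = \<epsilon> * dx\<^sup>2 / \<kappa> in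
      \<forall>n r. grid_point dx dt n r \<in> K \<longrightarrow>
        \<bar>slfd_truncation_error w0 s2 s4 s5 R dx dt \<phi> n r\<bar> \<le> C * g' dx dt" by blast
qed

section \<open>Elimination from the lattice Boltzmann model to the scheme\<close>

lemma exhaust_5: "(x::5) = 1 \<or> x = 2 \<or> x = 3 \<or> x = 4 \<or> x = 5"
proof (induct x)
  case (of_int z)
  then have "z = 0 \<or> z = 1 \<or> z = 2 \<or> z = 3 \<or> z = 4" by fastforce
  then show ?case by auto
qed

lemma UNIV_5: "UNIV = {1, 2, 3, 4, 5::5}"
  using exhaust_5 by auto

lemma sum_5: "sum f (UNIV::5 set) = f 1 + f 2 + f 3 + f 4 + f 5"
  unfolding UNIV_5 by (simp add: ac_simps)

lemma forall_5: "(\<forall>i::5. P i) \<longleftrightarrow> P 1 \<and> P 2 \<and> P 3 \<and> P 4 \<and> P 5"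
  by (metis exhaust_5)

lemma vector_5:
  "(vector [a, b, c, d, e] :: 'a::zero ^ 5) $ 1 = a"
  "(vector [a, b, c, d, e] :: 'a::zero ^ 5) $ 2 = b"
  "(vector [a, b, c, d, e] :: 'a::zero ^ 5) $ 3 = c"
  "(vector [a, b, c, d, e] :: 'a::zero ^ 5) $ 4 = d"
  "(vector [a, b, c, d, e] :: 'a::zero ^ 5) $ 5 = e"
  unfolding vector_def by simp_all

lemma lb_M_mult:
  "(lb_M c *v x) $ 1 = x $ 1 + x $ 2 + x $ 3 + x $ 4 + x $ 5"
  "(lb_M c *v x) $ 2 = c * (x $ 2 - x $ 4)"
  "(lb_M c *v x) $ 3 = c * (x $ 3 - x $ 5)"
  "(lb_M c *v x) $ 4 = c\<^sup>2 * (x $ 2 + x $ 3 + x $ 4 + x $ 5 - 4 * x $ 1)"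
  "(lb_M c *v x) $ 5 = c\<^sup>2 * (x $ 2 - x $ 3 + x $ 4 - x $ 5)"
  by (simp_all add: lb_M_def matrix_vector_mult_def sum_5 vector_5 algebra_simps)

lemma lb_S_mult:
  "(lb_S s1 s2 s4 s5 *v x) $ k = (vector [s1, s2, s2, s4, s5] :: real ^ 5) $ k * x $ k"
  by (simp add: lb_S_def matrix_vector_mult_def if_distrib[of "\<lambda>z. z * _"] cong: if_cong)

lemma invertible_lb_M:
  assumes "c \<noteq> 0" shows "invertible (lb_M c)"
proof -
  have "x = 0" if "lb_M c *v x = 0" for x
  proof -
    have "\<forall>k. (lb_M c *v x) $ k = 0" using that by simp
    then have "x $ 1 + x $ 2 + x $ 3 + x $ 4 + x $ 5 = 0" "x $ 2 = x $ 4" "x $ 3 = x $ 5"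
      "x $ 2 + x $ 3 + x $ 4 + x $ 5 - 4 * x $ 1 = 0" "x $ 2 - x $ 3 + x $ 4 - x $ 5 = 0"
      using assms by (auto simp: forall_5 lb_M_mult)
    then show ?thesis by (simp add: vec_eq_iff forall_5)
  qed
  then show ?thesis
    by (metis invertible_left_inverse matrix_left_invertible_ker)
qed

text \<open>
  It suffices to know the collision in moment space, so the inverse of \<open>M\<close> is never computed.
\<close>

lemma lb_M_mult_conjugate:
  assumes "c \<noteq> 0"
  shows "lb_M c *v ((matrix_inv (lb_M c) ** D ** lb_M c) *v x) = D *v (lb_M c *v x)"
proof -
  have "lb_M c ** matrix_inv (lb_M c) = mat 1"
    using someI_ex[OF invertible_lb_M[OF assms, unfolded invertible_def]]
    unfolding matrix_inv_def by blast
  then show ?thesis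
    by (simp add: matrix_vector_mul_assoc matrix_mul_assoc)
qed

text \<open>
  With half of the source of one time step added to the populations, their sum is \<open>\<phi>\<close>, and the
  collision becomes a relaxation towards \<open>w \<phi>\<close> followed by adding \<open>\<Delta>t w R\<close>. Each moment relaxes with
  its own rate; \<open>s1\<close> drops out, because the first moment is conserved up to the source.
\<close>

lemma collision_moments:
  fixes a P :: "real ^ 5"
  assumes c: "c \<noteq> 0" and \<phi>: "\<phi> = (\<Sum>k\<in>UNIV. a $ k) + dt / 2 * R"
    and P: "\<And>k. P $ k = a $ k
      - ((matrix_inv (lb_M c) ** lb_S s1 s2 s4 s5 ** lb_M c) *v (a - \<phi> *\<^sub>R lb_weight w0)) $ k
      + dt * ((matrix_inv (lb_M c) ** (mat 1 - (1 / 2) *\<^sub>R lb_S s1 s2 s4 s5) ** lb_M c) *v (R *\<^sub>R lb_weight w0)) $ k"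
  defines "F \<equiv> \<lambda>k. a $ k + dt / 2 * R * lb_weight w0 $ k"
    and "G \<equiv> \<lambda>k. P $ k + dt / 2 * R * lb_weight w0 $ k"
  shows "F 1 + F 2 + F 3 + F 4 + F 5 = \<phi>"
    and "G 1 = (1 - s4) * F 1 + s4 * w0 * \<phi> + dt * R * w0"
    and "G 1 + G 2 + G 3 + G 4 + G 5 = \<phi> + dt * R"
    and "G 2 - G 4 = (1 - s2) * (F 2 - F 4)"
    and "G 3 - G 5 = (1 - s2) * (F 3 - F 5)"
    and "G 2 - G 3 + G 4 - G 5 = (1 - s5) * (F 2 - F 3 + F 4 - F 5)"
proof -
  let ?M = "lb_M c" and ?S = "lb_S s1 s2 s4 s5" and ?w = "lb_weight w0"
  have w: "?w $ 1 = w0" "?w $ 2 = (1 - w0) / 4" "?w $ 3 = (1 - w0) / 4" "?w $ 4 = (1 - w0) / 4" "?w $ 5 = (1 - w0) / 4"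
    by (simp_all add: lb_weight_def vector_5)
  have "P = a - (matrix_inv ?M ** ?S ** ?M) *v (a - \<phi> *\<^sub>R ?w)
      + dt *\<^sub>R ((matrix_inv ?M ** (mat 1 - (1 / 2) *\<^sub>R ?S) ** ?M) *v (R *\<^sub>R ?w))"
    using P by (simp add: vec_eq_iff)
  then have "?M *v P = ?M *v a - ?S *v (?M *v (a - \<phi> *\<^sub>R ?w))
      + dt *\<^sub>R ((mat 1 - (1 / 2) *\<^sub>R ?S) *v (?M *v (R *\<^sub>R ?w)))"
    by (simp add: matrix_vector_right_distrib matrix_vector_mult_diff_distrib matrix_vector_mult_scaleR
      lb_M_mult_conjugate[OF c])
  then have *: "(?M *v P) $ k = (?M *v a) $ k - (?S *v (?M *v (a - \<phi> *\<^sub>R ?w))) $ k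
      + dt * ((?M *v (R *\<^sub>R ?w)) $ k - 1 / 2 * (?S *v (?M *v (R *\<^sub>R ?w))) $ k)" for k
    by (simp add: matrix_vector_mult_diff_rdistrib scaleR_matrix_vector_assoc[symmetric])
  have sum\<phi>: "a $ 1 + a $ 2 + a $ 3 + a $ 4 + a $ 5 = \<phi> - dt / 2 * R" using \<phi> by (simp add: sum_5)
  define A where "A = a $ 1 + a $ 2 + a $ 3 + a $ 4 + a $ 5"
  have "P $ 1 + P $ 2 + P $ 3 + P $ 4 + P $ 5 = A - s1 * (A - \<phi>) + dt * (1 - s1 / 2) * R"
    using *[of 1] by (simp add: lb_M_mult lb_S_mult vector_5 w A_def field_simps)
  moreover have "A = \<phi> - dt / 2 * R" using sum\<phi> by (simp add: A_def)
  ultimately have m1: "P $ 1 + P $ 2 + P $ 3 + P $ 4 + P $ 5 = \<phi> + dt / 2 * R"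
    by (simp add: field_simps)
  have m2: "P $ 2 - P $ 4 = (1 - s2) * (a $ 2 - a $ 4)"
  proof -
    have "c * (P $ 2 - P $ 4) = c * ((1 - s2) * (a $ 2 - a $ 4))"
      using *[of 2] by (simp add: lb_M_mult lb_S_mult vector_5 w field_simps)
    then show ?thesis using c by simp
  qed
  have m3: "P $ 3 - P $ 5 = (1 - s2) * (a $ 3 - a $ 5)"
  proof -
    have "c * (P $ 3 - P $ 5) = c * ((1 - s2) * (a $ 3 - a $ 5))"
      using *[of 3] by (simp add: lb_M_mult lb_S_mult vector_5 w field_simps)
    then show ?thesis using c by simp
  qed
  have m5: "P $ 2 - P $ 3 + P $ 4 - P $ 5 = (1 - s5) * (a $ 2 - a $ 3 + a $ 4 - a $ 5)"
  proof -
    have "c\<^sup>2 * (P $ 2 - P $ 3 + P $ 4 - P $ 5) = c\<^sup>2 * ((1 - s5) * (a $ 2 - a $ 3 + a $ 4 - a $ 5))"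
      using *[of 5] by (simp add: lb_M_mult lb_S_mult vector_5 w field_simps)
    then show ?thesis using c by simp
  qed
  have m4: "P $ 2 + P $ 3 + P $ 4 + P $ 5 - 4 * P $ 1
      = (1 - s4) * (a $ 2 + a $ 3 + a $ 4 + a $ 5 - 4 * a $ 1)
        + s4 * \<phi> * (1 - 5 * w0) + dt * (1 - s4 / 2) * R * (1 - 5 * w0)"
  proof -
    have "c\<^sup>2 * (P $ 2 + P $ 3 + P $ 4 + P $ 5 - 4 * P $ 1)
      = c\<^sup>2 * ((1 - s4) * (a $ 2 + a $ 3 + a $ 4 + a $ 5 - 4 * a $ 1)
        + s4 * \<phi> * (1 - 5 * w0) + dt * (1 - s4 / 2) * R * (1 - 5 * w0))"
      using *[of 4] by (simp add: lb_M_mult lb_S_mult vector_5 w field_simps)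
    then show ?thesis using c by simp
  qed
  show "F 1 + F 2 + F 3 + F 4 + F 5 = \<phi>"
    using sum\<phi> by (simp add: F_def w field_simps)
  show "G 1 + G 2 + G 3 + G 4 + G 5 = \<phi> + dt * R"
    using m1 by (simp add: G_def w field_simps)
  show "G 2 - G 4 = (1 - s2) * (F 2 - F 4)" "G 3 - G 5 = (1 - s2) * (F 3 - F 5)"
    "G 2 - G 3 + G 4 - G 5 = (1 - s5) * (F 2 - F 3 + F 4 - F 5)"
    using m2 m3 m5 by (simp_all add: G_def F_def w algebra_simps)
  have P1: "P $ 2 + P $ 3 + P $ 4 + P $ 5 = \<phi> + dt / 2 * R - P $ 1" using m1 by simp
  have a1: "a $ 2 + a $ 3 + a $ 4 + a $ 5 = \<phi> - dt / 2 * R - a $ 1" using sum\<phi> by simp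
  have "\<phi> + dt / 2 * R - P $ 1 - 4 * P $ 1 = (1 - s4) * (\<phi> - dt / 2 * R - a $ 1 - 4 * a $ 1)
        + s4 * \<phi> * (1 - 5 * w0) + dt * (1 - s4 / 2) * R * (1 - 5 * w0)"
    using m4 unfolding P1 a1 .
  then have "5 * G 1 = 5 * ((1 - s4) * F 1 + s4 * w0 * \<phi> + dt * R * w0)"
    by (simp add: G_def F_def w field_simps)
  then show "G 1 = (1 - s4) * F 1 + s4 * w0 * \<phi> + dt * R * w0" by simp
qed

text \<open>
  Along one axis, \<open>E\<close> and \<open>J\<close> are the sum and difference of the two populations moving in opposite
  directions, \<open>G\<close> is the sum after collision, and \<open>b\<close> is the factor by which collision damps \<open>J\<close>.
  With the average \<open>C\<close> and the half difference \<open>D\<close> of the two shifts, \<open>E' = C G + b D J\<close> and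
  \<open>J' = D G + b C J\<close>. Then \<open>J\<close> drops out of \<open>E'' - b C E'\<close>, and \<open>C\<^sup>2 - D\<^sup>2 = 1\<close> gives the coefficient of the last
  term.
\<close>

lemma eliminate_flux:
  fixes E J G :: "int \<Rightarrow> int \<Rightarrow> real"
  assumes E: "\<And>n i. n \<ge> 0 \<Longrightarrow> E (n + 1) i = (G n (i - 1) + G n (i + 1)) / 2 + b * (J n (i - 1) - J n (i + 1)) / 2"
    and J: "\<And>n i. n \<ge> 0 \<Longrightarrow> J (n + 1) i = (G n (i - 1) - G n (i + 1)) / 2 + b * (J n (i - 1) + J n (i + 1)) / 2"
    and n: "n \<ge> 0"
  shows "E (n + 2) i = b * (E (n + 1) (i - 1) + E (n + 1) (i + 1)) / 2
    + (G (n + 1) (i - 1) + G (n + 1) (i + 1)) / 2 - b * G n i"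
proof -
  have "E (n + 2) i = (G (n + 1) (i - 1) + G (n + 1) (i + 1)) / 2 + b * (J (n + 1) (i - 1) - J (n + 1) (i + 1)) / 2"
    using E[of "n + 1" i] n by (simp add: add.assoc)
  then show ?thesis
    using arg_cong[OF E[OF n, of "i - 1"], of "(*) b"] arg_cong[OF E[OF n, of "i + 1"], of "(*) b"]
      arg_cong[OF J[OF n, of "i - 1"], of "(*) b"] arg_cong[OF J[OF n, of "i + 1"], of "(*) b"]
    by (simp add: algebra_simps add_divide_distrib diff_divide_distrib)
qed

definition Sigma_diff :: "(int \<times> int \<Rightarrow> real) \<Rightarrow> int \<times> int \<Rightarrow> real" where
  "Sigma_diff v = (\<lambda>(i, j). v (i - 1, j) + v (i + 1, j) - v (i, j - 1) - v (i, j + 1))"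

text \<open>
  \<open>(a + b)\<^sup>2 - (a - b)\<^sup>2 = 4 a b\<close> for the sums \<open>a\<close> and \<open>b\<close> of the two shifts along either axis. This is why the
  scheme reaches only to the diagonal neighbours although the elimination squares these operators.
\<close>

lemma Sigma_square_diff:
  "Sigma1 (Sigma1 v) r - Sigma_diff (Sigma_diff v) r = 4 * Sigma2 v r"
  by (cases r) (simp add: Sigma1_def Sigma_diff_def Sigma2_def)

lemma Sigma_linear:
  "Sigma1 (\<lambda>r. u r + v r) r = Sigma1 u r + Sigma1 v r"
  "Sigma1 (\<lambda>r. u r - v r) r = Sigma1 u r - Sigma1 v r"
  "Sigma1 (\<lambda>r. a * v r) r = a * Sigma1 v r"
  "Sigma1 (\<lambda>r. v r / a) r = Sigma1 v r / a"
  "Sigma1 (\<lambda>r. a) r = 4 * a"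
  "Sigma_diff (\<lambda>r. u r + v r) r = Sigma_diff u r + Sigma_diff v r"
  "Sigma_diff (\<lambda>r. u r - v r) r = Sigma_diff u r - Sigma_diff v r"
  "Sigma_diff (\<lambda>r. a * v r) r = a * Sigma_diff v r"
  "Sigma_diff (\<lambda>r. v r / a) r = Sigma_diff v r / a"
  "Sigma_diff (\<lambda>r. a) r = 0"
  by (cases r; simp add: Sigma1_def Sigma_diff_def algebra_simps add_divide_distrib diff_divide_distrib)+

lemma Sigma_commute: "Sigma1 (Sigma_diff v) r = Sigma_diff (Sigma1 v) r"
  by (cases r) (simp add: Sigma1_def Sigma_diff_def algebra_simps)

text \<open>
  Here \<open>F\<close> is the population at rest and \<open>P\<close> the difference of the populations on the two axes. Applying
  \<open>T - (1 - s4)\<close>, with \<open>T\<close> the shift in time, expresses everything in \<open>F\<close> through \<open>u\<close>: it turns \<open>u - F\<close>, \<open>\<psi>\<close>,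
  \<open>Z\<close>, \<open>P\<close> into \<open>N'\<close>, \<open>\<psi>'\<close>, \<open>Z'\<close>, \<open>P'\<close>. Then \<open>P'\<close> satisfies an equation of second order in time with operator
  \<open>2 T\<^sup>2 - (a + b) / 2 \<Sigma>\<^sub>1 T + 2 a b\<close>. In \<open>V\<close> all terms of the equation
  for \<open>N'\<close> are collected except the one with \<open>P'\<close>; applying the operator to \<open>V\<close> therefore removes \<open>P'\<close>,
  because all operators commute.
\<close>

lemma eliminate_populations:
  fixes u F P :: "int \<Rightarrow> int \<times> int \<Rightarrow> real" and \<rho> a b s4 k w0 :: real
  defines "\<psi> \<equiv> \<lambda>n r. u n r + \<rho> - F (n + 1) r"
  defines "Z \<equiv> \<lambda>n r. b * (u n r - F n r) + \<psi> n r"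
  assumes F: "\<And>n r. n \<ge> 0 \<Longrightarrow> F (n + 1) r = (1 - s4) * F n r + k * u n r + w0 * \<rho>"
    and N: "\<And>n r. n \<ge> 0 \<Longrightarrow> 2 * (u (n + 2) r - F (n + 2) r)
      = Sigma1 (Z (n + 1)) r / 2 - 2 * b * \<psi> n r + (a + b) / 2 * Sigma_diff (P (n + 1)) r"
    and P: "\<And>n r. n \<ge> 0 \<Longrightarrow> 2 * P (n + 2) r
      = (a + b) / 2 * Sigma1 (P (n + 1)) r - 2 * a * b * P n r + Sigma_diff (Z (n + 1)) r / 2"
    and n: "n \<ge> 0"
  defines "N' \<equiv> \<lambda>n r. u (n + 1) r - (1 - s4 + k) * u n r - w0 * \<rho>"
  defines "\<psi>' \<equiv> \<lambda>n r. (1 - k) * u (n + 1) r - (1 - s4) * u n r + (s4 - w0) * \<rho>"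
  defines "Z' \<equiv> \<lambda>n r. b * N' n r + \<psi>' n r"
  defines "V \<equiv> \<lambda>n r. 2 * N' (n + 2) r - Sigma1 (Z' (n + 1)) r / 2 + 2 * b * \<psi>' n r"
  shows "2 * V (n + 2) r - (a + b) / 2 * Sigma1 (V (n + 1)) r + 2 * a * b * V n r
    = (a + b) / 4 * Sigma_diff (Sigma_diff (Z' (n + 2))) r"
proof -
  define P' where "P' = (\<lambda>n r. P (n + 1) r - (1 - s4) * P n r)"
  have \<psi>': "\<psi>' n r = \<psi> (n + 1) r - (1 - s4) * \<psi> n r" if "n \<ge> 0" for n r
    using F[of n r] F[of "n + 1" r] that by (simp add: \<psi>_def \<psi>'_def algebra_simps)
  have N': "N' n r = (u (n + 1) r - F (n + 1) r) - (1 - s4) * (u n r - F n r)" if "n \<ge> 0" for n r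
    using F[of n r] that by (simp add: N'_def algebra_simps)
  have Z': "Z' n r = Z (n + 1) r - (1 - s4) * Z n r" if "n \<ge> 0" for n r
    using that by (simp add: Z'_def Z_def N' \<psi>' algebra_simps)
  have lin: "Sigma1 (\<lambda>r. x r - c * y r) r = Sigma1 x r - c * Sigma1 y r"
    "Sigma_diff (\<lambda>r. x r - c * y r) r = Sigma_diff x r - c * Sigma_diff y r" for x y c r
    by (simp_all add: Sigma_linear)
  have SZ: "Sigma1 (Z' n) r = Sigma1 (Z (n + 1)) r - (1 - s4) * Sigma1 (Z n) r"
    "Sigma_diff (Z' n) r = Sigma_diff (Z (n + 1)) r - (1 - s4) * Sigma_diff (Z n) r" if "n \<ge> 0" for n r
  proof -
    have "Z' n = (\<lambda>r. Z (n + 1) r - (1 - s4) * Z n r)" using Z' that by auto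
    then show "Sigma1 (Z' n) r = Sigma1 (Z (n + 1)) r - (1 - s4) * Sigma1 (Z n) r"
      "Sigma_diff (Z' n) r = Sigma_diff (Z (n + 1)) r - (1 - s4) * Sigma_diff (Z n) r"
      by (simp_all only: lin)
  qed
  have SP: "Sigma1 (P' n) r = Sigma1 (P (n + 1)) r - (1 - s4) * Sigma1 (P n) r"
    "Sigma_diff (P' n) r = Sigma_diff (P (n + 1)) r - (1 - s4) * Sigma_diff (P n) r" for n r
    unfolding P'_def by (simp_all only: lin)
  have P': "P' n r = P (n + 1) r - (1 - s4) * P n r" for n r by (simp add: P'_def)
  have P'eq: "2 * P' (n + 2) r - (a + b) / 2 * Sigma1 (P' (n + 1)) r + 2 * a * b * P' n r
      = Sigma_diff (Z' (n + 1)) r / 2" if "n \<ge> 0" for n r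
  proof -
    have "2 * P (n + 2) r * (1 - s4)
      = ((a + b) / 2 * Sigma1 (P (n + 1)) r - 2 * a * b * P n r + Sigma_diff (Z (n + 1)) r / 2) * (1 - s4)"
      using P[OF that, of r] by simp
    then show ?thesis
      using P[of "n + 1" r] that
      by (simp add: P' SP SZ algebra_simps add_divide_distrib diff_divide_distrib)
  qed
  have V: "V n r = (a + b) / 2 * Sigma_diff (P' (n + 1)) r" if "n \<ge> 0" for n r
  proof -
    have "2 * (u (n + 2) r - F (n + 2) r) * (1 - s4)
      = (Sigma1 (Z (n + 1)) r / 2 - 2 * b * \<psi> n r + (a + b) / 2 * Sigma_diff (P (n + 1)) r) * (1 - s4)"
      using N[OF that, of r] by simp
    then show ?thesis
      using N[of "n + 1" r] that
      by (simp add: V_def N' \<psi>' SZ SP algebra_simps add_divide_distrib diff_divide_distrib)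
  qed
  have "2 * V (n + 2) r - (a + b) / 2 * Sigma1 (V (n + 1)) r + 2 * a * b * V n r
    = (a + b) / 2 * Sigma_diff (\<lambda>r. 2 * P' (n + 3) r - (a + b) / 2 * Sigma1 (P' (n + 2)) r + 2 * a * b * P' (n + 1) r) r"
  proof -
    have V1: "V (n + 1) = (\<lambda>r. (a + b) / 2 * Sigma_diff (P' (n + 2)) r)"
      using V[of "n + 1"] n by (auto simp: add.assoc)
    have "V n r = (a + b) / 2 * Sigma_diff (P' (n + 1)) r"
      "V (n + 2) r = (a + b) / 2 * Sigma_diff (P' (n + 3)) r"
      using V[of n r] V[of "n + 2" r] n by (simp_all add: add.assoc)
    then show ?thesis
      by (simp only: V1 Sigma_linear Sigma_commute) (simp add: algebra_simps)
  qed
  also have "(\<lambda>r. 2 * P' (n + 3) r - (a + b) / 2 * Sigma1 (P' (n + 2)) r + 2 * a * b * P' (n + 1) r)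
     = (\<lambda>r. 1 / 2 * Sigma_diff (Z' (n + 2)) r)"
    using P'eq[of "n + 1"] n by (auto simp: add.assoc)
  finally show ?thesis by (simp only: Sigma_linear)
qed

text \<open>
  Inserting the definitions turns the eliminated equation into four times the scheme; the squares
  \<open>\<Sigma>\<^sub>1\<^sup>2\<close> on the left and the squared difference on the right combine to \<open>4 \<Sigma>\<^sub>2\<close>.
\<close>

lemma eliminated_eq_slfd:
  fixes u :: "int \<Rightarrow> int \<times> int \<Rightarrow> real" and s2 s4 s5 w0 dt R :: real
  defines "a \<equiv> 1 - s5" and "b \<equiv> 1 - s2" and "k \<equiv> s4 * w0" and "\<rho> \<equiv> dt * R"
  defines "N' \<equiv> \<lambda>n r. u (n + 1) r - (1 - s4 + k) * u n r - w0 * \<rho>"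
  defines "\<psi>' \<equiv> \<lambda>n r. (1 - k) * u (n + 1) r - (1 - s4) * u n r + (s4 - w0) * \<rho>"
  defines "Z' \<equiv> \<lambda>n r. b * N' n r + \<psi>' n r"
  defines "V \<equiv> \<lambda>n r. 2 * N' (n + 2) r - Sigma1 (Z' (n + 1)) r / 2 + 2 * b * \<psi>' n r"
  assumes "2 * V (n + 2) r - (a + b) / 2 * Sigma1 (V (n + 1)) r + 2 * a * b * V n r
    = (a + b) / 4 * Sigma_diff (Sigma_diff (Z' (n + 2))) r"
  shows "u (n + 5) r = slfd_rhs w0 s2 s4 s5 R dt u (n + 4) r"
proof -
  have sq: "Sigma1 (Sigma1 v) r = Sigma_diff (Sigma_diff v) r + 4 * Sigma2 v r" for v
    using Sigma_square_diff[of v r] by simp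
  define c where "c = b + 1 - k"
  define d where "d = b * (1 - s4 + k) + (1 - s4)"
  define e where "e = (s4 - w0 - b * w0) * \<rho>"
  have Z: "Z' n = (\<lambda>r. c * u (n + 1) r - d * u n r + e)" for n
    by (simp add: Z'_def N'_def \<psi>'_def c_def d_def e_def algebra_simps)
  have S1: "Sigma1 (Z' n) r = c * Sigma1 (u (n + 1)) r - d * Sigma1 (u n) r + 4 * e" for n r
    by (simp only: Z Sigma_linear)
  have D1: "Sigma_diff (Z' n) = (\<lambda>r. c * Sigma_diff (u (n + 1)) r - d * Sigma_diff (u n) r)" for n
    by (rule ext, simp only: Z Sigma_linear)
  have D: "Sigma_diff (Sigma_diff (Z' n)) r
      = c * Sigma_diff (Sigma_diff (u (n + 1))) r - d * Sigma_diff (Sigma_diff (u n)) r" for n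
    by (simp only: D1 Sigma_linear)
  have V: "V n = (\<lambda>r. 2 * N' (n + 2) r - (c * Sigma1 (u (n + 2)) r - d * Sigma1 (u (n + 1)) r + 4 * e) / 2
      + 2 * b * \<psi>' n r)" for n
    by (simp add: V_def S1 add.assoc)
  have SV: "Sigma1 (V n) r = 2 * (Sigma1 (u (n + 3)) r - (1 - s4 + k) * Sigma1 (u (n + 2)) r - 4 * (w0 * \<rho>))
     - (c * (Sigma_diff (Sigma_diff (u (n + 2))) r + 4 * Sigma2 (u (n + 2)) r)
        - d * (Sigma_diff (Sigma_diff (u (n + 1))) r + 4 * Sigma2 (u (n + 1)) r) + 16 * e) / 2
     + 2 * b * ((1 - k) * Sigma1 (u (n + 1)) r - (1 - s4) * Sigma1 (u n) r + 4 * ((s4 - w0) * \<rho>))" for n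
    unfolding V N'_def \<psi>'_def by (simp only: Sigma_linear sq) (simp add: add.assoc)
  have V0: "V n r = 2 * (u (n + 3) r - (1 - s4 + k) * u (n + 2) r - w0 * \<rho>)
     - (c * Sigma1 (u (n + 2)) r - d * Sigma1 (u (n + 1)) r + 4 * e) / 2
     + 2 * b * ((1 - k) * u (n + 1) r - (1 - s4) * u n r + (s4 - w0) * \<rho>)" for n
    unfolding V N'_def \<psi>'_def by (simp add: add.assoc)
  have idx: "n + 2 + 3 = n + 5" "n + 2 + 2 = n + 4" "n + 2 + 1 = n + 3" "n + 1 + 3 = n + 4"
     "n + 1 + 2 = n + 3" "n + 1 + 1 = n + 2"
     "n + 4 - 1 = n + 3" "n + 4 - 2 = n + 2" "n + 4 - 3 = n + 1" "n + 4 - 4 = n" by simp_all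
  have "4 * u (n + 5) r = 4 * slfd_rhs w0 s2 s4 s5 R dt u (n + 4) r"
    using assms(9) unfolding SV V0 D slfd_rhs_def Let_def slfd_delta_def idx c_def d_def e_def a_def b_def k_def \<rho>_def
    by (simp add: power2_eq_square algebra_simps add_divide_distrib diff_divide_distrib)
  then show ?thesis by simp
qed

text \<open>
  Each pair of opposite populations obeys the one-dimensional elimination of the flux along its axis.
  In the sum and the difference of the two resulting equations, the populations enter only through
  \<open>\<phi>\<close>, the population at rest and \<open>P\<close>. The oldest level used is \<open>n - 4\<close>, which must not precede the
  start of the run.
\<close>

lemma mrt_lb_run_slfd:
  assumes run: "mrt_lb_run w0 s1 s2 s4 s5 R dx dt f" and dx: "dx > 0" and dt: "dt > 0" and n: "n \<ge> 4"
  shows "lb_phi dt R f (n + 1) r = slfd_rhs w0 s2 s4 s5 R dt (lb_phi dt R f) n r"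
proof -
  define w where "w = lb_weight w0"
  define u where "u = lb_phi dt R f"
  define A where "A k n r = f n r $ k + dt / 2 * R * w $ k" for k n r
  define G where "G k n r = A k (n + 1) (r + lattice_dir $ k)" for k n r
  define \<rho> where "\<rho> = dt * R"
  have c: "dx / dt \<noteq> 0" using dx dt by simp
  have col: "A 1 n r + A 2 n r + A 3 n r + A 4 n r + A 5 n r = u n r"
    "G 1 n r = (1 - s4) * A 1 n r + s4 * w0 * u n r + w0 * \<rho>"
    "G 1 n r + G 2 n r + G 3 n r + G 4 n r + G 5 n r = u n r + \<rho>"
    "G 2 n r - G 4 n r = (1 - s2) * (A 2 n r - A 4 n r)"
    "G 3 n r - G 5 n r = (1 - s2) * (A 3 n r - A 5 n r)"
    "G 2 n r - G 3 n r + G 4 n r - G 5 n r = (1 - s5) * (A 2 n r - A 3 n r + A 4 n r - A 5 n r)"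
    if "n \<ge> 0" for n r
  proof -
    define P :: "real ^ 5" where "P = (\<chi> k. f (n + 1) (r + lattice_dir $ k) $ k)"
    have u: "u n r = (\<Sum>k\<in>UNIV. f n r $ k) + dt / 2 * R" by (simp add: u_def lb_phi_def)
    have P: "P $ k = f n r $ k
      - ((matrix_inv (lb_M (dx / dt)) ** lb_S s1 s2 s4 s5 ** lb_M (dx / dt)) *v (f n r - u n r *\<^sub>R lb_weight w0)) $ k
      + dt * ((matrix_inv (lb_M (dx / dt)) ** (mat 1 - (1 / 2) *\<^sub>R lb_S s1 s2 s4 s5) ** lb_M (dx / dt))
          *v (R *\<^sub>R lb_weight w0)) $ k" for k
      using run[unfolded mrt_lb_run_def Let_def, rule_format, OF that, of r k] by (simp add: P_def u_def)
    have "G k n r = P $ k + dt / 2 * R * lb_weight w0 $ k" for k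
      by (simp add: G_def A_def P_def w_def)
    then show "A 1 n r + A 2 n r + A 3 n r + A 4 n r + A 5 n r = u n r"
      "G 1 n r = (1 - s4) * A 1 n r + s4 * w0 * u n r + w0 * \<rho>"
      "G 1 n r + G 2 n r + G 3 n r + G 4 n r + G 5 n r = u n r + \<rho>"
      "G 2 n r - G 4 n r = (1 - s2) * (A 2 n r - A 4 n r)"
      "G 3 n r - G 5 n r = (1 - s2) * (A 3 n r - A 5 n r)"
      "G 2 n r - G 3 n r + G 4 n r - G 5 n r = (1 - s5) * (A 2 n r - A 3 n r + A 4 n r - A 5 n r)"
      using collision_moments[OF c u P] by (simp_all add: A_def w_def \<rho>_def mult.commute[of w0])
  qed
  have stream: "A 1 (n + 1) (i, j) = G 1 n (i, j)"
    "A 2 (n + 1) (i, j) = G 2 n (i - 1, j)" "A 4 (n + 1) (i, j) = G 4 n (i + 1, j)"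
    "A 3 (n + 1) (i, j) = G 3 n (i, j - 1)" "A 5 (n + 1) (i, j) = G 5 n (i, j + 1)" for n i j
    by (simp_all add: G_def lattice_dir_def vector_5)
  define P where "P n r = A 2 n r + A 4 n r - A 3 n r - A 5 n r" for n r
  define \<psi> where "\<psi> n r = u n r + \<rho> - A 1 (n + 1) r" for n r
  have F: "A 1 (n + 1) r = (1 - s4) * A 1 n r + s4 * w0 * u n r + w0 * \<rho>" if "n \<ge> 0" for n r
    using col(2)[OF that, of r] stream(1)[of n "fst r" "snd r"] by simp
  have Gx: "G 2 n r + G 4 n r = (\<psi> n r + (1 - s5) * P n r) / 2"
    and Gy: "G 3 n r + G 5 n r = (\<psi> n r - (1 - s5) * P n r) / 2" if "n \<ge> 0" for n r
  proof -
    have "G 2 n r + G 4 n r + (G 3 n r + G 5 n r) = \<psi> n r"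
      using col(3)[OF that, of r] stream(1)[of n "fst r" "snd r"] by (simp add: \<psi>_def)
    moreover have "G 2 n r + G 4 n r - (G 3 n r + G 5 n r) = (1 - s5) * P n r"
      using col(6)[OF that, of r] by (simp add: P_def algebra_simps)
    ultimately show "G 2 n r + G 4 n r = (\<psi> n r + (1 - s5) * P n r) / 2"
      "G 3 n r + G 5 n r = (\<psi> n r - (1 - s5) * P n r) / 2" by simp_all
  qed
  have Ax: "A 2 n r + A 4 n r = (u n r - A 1 n r + P n r) / 2"
    and Ay: "A 3 n r + A 5 n r = (u n r - A 1 n r - P n r) / 2" if "n \<ge> 0" for n r
    using col(1)[OF that, of r] by (simp_all add: P_def field_simps)
  let ?b = "1 - s2"
  have x: "A 2 (n + 2) (i, j) + A 4 (n + 2) (i, j)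
     = ?b * ((A 2 (n + 1) (i - 1, j) + A 4 (n + 1) (i - 1, j)) + (A 2 (n + 1) (i + 1, j) + A 4 (n + 1) (i + 1, j))) / 2
      + ((G 2 (n + 1) (i - 1, j) + G 4 (n + 1) (i - 1, j)) + (G 2 (n + 1) (i + 1, j) + G 4 (n + 1) (i + 1, j))) / 2
      - ?b * (G 2 n (i, j) + G 4 n (i, j))" if "n \<ge> 0" for n i j
  proof (rule eliminate_flux[where J = "\<lambda>n i. A 2 n (i, j) - A 4 n (i, j)", OF _ _ that])
    fix n i :: int assume "n \<ge> 0"
    note m = col(4)[OF this, of "(i - 1, j)"] col(4)[OF this, of "(i + 1, j)"]
    show "A 2 (n + 1) (i, j) + A 4 (n + 1) (i, j)
      = (G 2 n (i - 1, j) + G 4 n (i - 1, j) + (G 2 n (i + 1, j) + G 4 n (i + 1, j))) / 2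
        + ?b * (A 2 n (i - 1, j) - A 4 n (i - 1, j) - (A 2 n (i + 1, j) - A 4 n (i + 1, j))) / 2"
      by (simp only: stream right_diff_distrib[of ?b "A 2 n (i - 1, j) - A 4 n (i - 1, j)"] m[symmetric]) (simp add: field_simps)
    show "A 2 (n + 1) (i, j) - A 4 (n + 1) (i, j)
      = (G 2 n (i - 1, j) + G 4 n (i - 1, j) - (G 2 n (i + 1, j) + G 4 n (i + 1, j))) / 2
        + ?b * (A 2 n (i - 1, j) - A 4 n (i - 1, j) + (A 2 n (i + 1, j) - A 4 n (i + 1, j))) / 2"
      by (simp only: stream distrib_left[of ?b "A 2 n (i - 1, j) - A 4 n (i - 1, j)"] m[symmetric]) (simp add: field_simps)
  qed
  have y: "A 3 (n + 2) (i, j) + A 5 (n + 2) (i, j)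
     = ?b * ((A 3 (n + 1) (i, j - 1) + A 5 (n + 1) (i, j - 1)) + (A 3 (n + 1) (i, j + 1) + A 5 (n + 1) (i, j + 1))) / 2
      + ((G 3 (n + 1) (i, j - 1) + G 5 (n + 1) (i, j - 1)) + (G 3 (n + 1) (i, j + 1) + G 5 (n + 1) (i, j + 1))) / 2
      - ?b * (G 3 n (i, j) + G 5 n (i, j))" if "n \<ge> 0" for n i j
  proof (rule eliminate_flux[where J = "\<lambda>n j. A 3 n (i, j) - A 5 n (i, j)", OF _ _ that])
    fix n j :: int assume "n \<ge> 0"
    note m = col(5)[OF this, of "(i, j - 1)"] col(5)[OF this, of "(i, j + 1)"]
    show "A 3 (n + 1) (i, j) + A 5 (n + 1) (i, j)
      = (G 3 n (i, j - 1) + G 5 n (i, j - 1) + (G 3 n (i, j + 1) + G 5 n (i, j + 1))) / 2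
        + ?b * (A 3 n (i, j - 1) - A 5 n (i, j - 1) - (A 3 n (i, j + 1) - A 5 n (i, j + 1))) / 2"
      by (simp only: stream right_diff_distrib[of ?b "A 3 n (i, j - 1) - A 5 n (i, j - 1)"] m[symmetric]) (simp add: field_simps)
    show "A 3 (n + 1) (i, j) - A 5 (n + 1) (i, j)
      = (G 3 n (i, j - 1) + G 5 n (i, j - 1) - (G 3 n (i, j + 1) + G 5 n (i, j + 1))) / 2
        + ?b * (A 3 n (i, j - 1) - A 5 n (i, j - 1) + (A 3 n (i, j + 1) - A 5 n (i, j + 1))) / 2"
      by (simp only: stream distrib_left[of ?b "A 3 n (i, j - 1) - A 5 n (i, j - 1)"] m[symmetric]) (simp add: field_simps)
  qed
  have moments: "2 * (u (n + 2) r - A 1 (n + 2) r)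
      = Sigma1 (\<lambda>r. ?b * (u (n + 1) r - A 1 (n + 1) r) + (u (n + 1) r + \<rho> - A 1 (n + 1 + 1) r)) r / 2
        - 2 * ?b * (u n r + \<rho> - A 1 (n + 1) r) + (1 - s5 + ?b) / 2 * Sigma_diff (P (n + 1)) r"
    "2 * P (n + 2) r = (1 - s5 + ?b) / 2 * Sigma1 (P (n + 1)) r - 2 * (1 - s5) * ?b * P n r
        + Sigma_diff (\<lambda>r. ?b * (u (n + 1) r - A 1 (n + 1) r) + (u (n + 1) r + \<rho> - A 1 (n + 1 + 1) r)) r / 2"
    if n0: "n \<ge> 0" for n r
  proof -
    obtain i j where r: "r = (i, j)" by (cases r)
    have n1: "n + 1 \<ge> 0" "n + 2 \<ge> 0" using n0 by simp_all
    note xy = x[OF n0, of i j, unfolded Ax[OF n1(1)] Ax[OF n1(2)] Gx[OF n0] Gx[OF n1(1)]]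
      y[OF n0, of i j, unfolded Ay[OF n1(1)] Ay[OF n1(2)] Gy[OF n0] Gy[OF n1(1)]]
    show "2 * (u (n + 2) r - A 1 (n + 2) r)
      = Sigma1 (\<lambda>r. ?b * (u (n + 1) r - A 1 (n + 1) r) + (u (n + 1) r + \<rho> - A 1 (n + 1 + 1) r)) r / 2
        - 2 * ?b * (u n r + \<rho> - A 1 (n + 1) r) + (1 - s5 + ?b) / 2 * Sigma_diff (P (n + 1)) r"
      using xy unfolding r Sigma1_def Sigma_diff_def \<psi>_def
      by (simp add: algebra_simps add_divide_distrib diff_divide_distrib)
    show "2 * P (n + 2) r = (1 - s5 + ?b) / 2 * Sigma1 (P (n + 1)) r - 2 * (1 - s5) * ?b * P n r
        + Sigma_diff (\<lambda>r. ?b * (u (n + 1) r - A 1 (n + 1) r) + (u (n + 1) r + \<rho> - A 1 (n + 1 + 1) r)) r / 2"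
      using xy unfolding r Sigma1_def Sigma_diff_def \<psi>_def
      by (simp add: algebra_simps add_divide_distrib diff_divide_distrib)
  qed
  have "u (n - 4 + 5) r = slfd_rhs w0 s2 s4 s5 R dt u (n - 4 + 4) r"
    using eliminate_populations[where u = u and F = "A 1" and P = P, OF F moments, of "n - 4" r] n
    unfolding \<rho>_def by (intro eliminated_eq_slfd) simp
  then show ?thesis by (simp add: u_def add.commute[of 1])
qed

section \<open>The accuracy theorem\<close>

lemma slfd_rhs_diff:
  "slfd_rhs w0 s2 s4 s5 0 dt (\<lambda>n r. u n r - v n r) n r
    = slfd_rhs w0 s2 s4 s5 R dt u n r - slfd_rhs w0 s2 s4 s5 R dt v n r"
proof -
  have S: "Sigma1 (\<lambda>r. u k r - v k r) r = Sigma1 (u k) r - Sigma1 (v k) r"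
    "Sigma2 (\<lambda>r. u k r - v k r) r = Sigma2 (u k) r - Sigma2 (v k) r" for k r
    by (cases r; simp add: Sigma1_def Sigma2_def)+
  show ?thesis
    by (rule slfd_rhs_linear_form[of w0 s2 s4 s5]) (simp add: S algebra_simps)
qed

text \<open>
  A run satisfies the scheme exactly and the scheme is affine, so the error newly made in a step is the
  truncation error at the exact solution.
\<close>

lemma mrt_lb_accuracy_if_slfd_accuracy:
  assumes \<kappa>: "\<kappa> > 0" and \<epsilon>: "\<epsilon> > 0" and acc: "slfd_accuracy \<kappa> R \<epsilon> w0 s2 s4 s5 g"
  shows "mrt_lb_accuracy \<kappa> R \<epsilon> w0 s1 s2 s4 s5 g"
  unfolding mrt_lb_accuracy_def
proof (intro allI impI)
  fix U K :: "(real \<times> real \<times> real) set" and \<phi>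
  assume a: "open U" "Ck_on 6 \<phi> U" "diffusion_solution_on U \<kappa> R \<phi>" "compact K" "K \<subseteq> U"
  then obtain C where "\<forall>\<^sub>F dx in at_right 0. let dt = \<epsilon> * dx\<^sup>2 / \<kappa> in
      \<forall>n r. grid_point dx dt n r \<in> K \<longrightarrow>
        \<bar>slfd_truncation_error w0 s2 s4 s5 R dx dt \<phi> n r\<bar> \<le> C * g dx dt"
    using acc unfolding slfd_accuracy_def by blast
  moreover have "\<forall>\<^sub>F s in at_right (0::real). s > 0" by (simp add: eventually_at_right_less)
  ultimately have "\<forall>\<^sub>F dx in at_right 0. let dt = \<epsilon> * dx\<^sup>2 / \<kappa> in
           \<forall>f. mrt_lb_run w0 s1 s2 s4 s5 R dx dt f \<longrightarrow>
             (let e = (\<lambda>n r. grid_values dx dt \<phi> n r - lb_phi dt R f n r) in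
              \<forall>n\<ge>4. \<forall>r. grid_point dx dt n r \<in> K \<longrightarrow>
                \<bar>(e (n + 1) r - slfd_rhs w0 s2 s4 s5 0 dt e n r) / (dt * slfd_delta s2 s4 s5)\<bar>
                  \<le> C * g dx dt)"
  proof eventually_elim
    case (elim dx)
    define dt where "dt = \<epsilon> * dx\<^sup>2 / \<kappa>"
    have dt: "dt > 0" using \<kappa> \<epsilon> elim by (simp add: dt_def)
    show ?case unfolding Let_def dt_def[symmetric]
    proof (intro allI impI)
      fix f n r assume f: "mrt_lb_run w0 s1 s2 s4 s5 R dx dt f" and n: "(4::int) \<le> n"
        and inK: "grid_point dx dt n r \<in> K"
      have eq: "(grid_values dx dt \<phi> (n + 1) r - lb_phi dt R f (n + 1) r -
          slfd_rhs w0 s2 s4 s5 0 dt (\<lambda>n r. grid_values dx dt \<phi> n r - lb_phi dt R f n r) n r) / (dt * slfd_delta s2 s4 s5)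
        = slfd_truncation_error w0 s2 s4 s5 R dx dt \<phi> n r"
        unfolding slfd_rhs_diff[where R = R] slfd_truncation_error_def Let_def
        using mrt_lb_run_slfd[OF f elim(2) dt n, of r] by simp
      then show "\<bar>(grid_values dx dt \<phi> (n + 1) r - lb_phi dt R f (n + 1) r -
          slfd_rhs w0 s2 s4 s5 0 dt (\<lambda>n r. grid_values dx dt \<phi> n r - lb_phi dt R f n r) n r) / (dt * slfd_delta s2 s4 s5)\<bar>
         \<le> C * g dx dt"
        unfolding eq using elim(1) inK unfolding Let_def dt_def[symmetric] by blast
    qed
  qed
  then show "\<exists>C. \<forall>\<^sub>F dx in at_right 0. let dt = \<epsilon> * dx\<^sup>2 / \<kappa> in
           \<forall>f. mrt_lb_run w0 s1 s2 s4 s5 R dx dt f \<longrightarrow>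
             (let e = (\<lambda>n r. grid_values dx dt \<phi> n r - lb_phi dt R f n r) in
              \<forall>n\<ge>4. \<forall>r. grid_point dx dt n r \<in> K \<longrightarrow>
                \<bar>(e (n + 1) r - slfd_rhs w0 s2 s4 s5 0 dt e n r) / (dt * slfd_delta s2 s4 s5)\<bar>
                  \<le> C * g dx dt)" by blast
qed

theorem mainTheorem3:
  fixes \<kappa> R \<epsilon> w0 s2 s4 s5 :: real
  assumes "\<kappa> > 0" and "\<epsilon> > 0" and "s5 \<in> {0<..<2}"
    and "s5 - 6 \<noteq> 0" and "2 * s5 - 36 * \<epsilon> + 24 * \<epsilon> * s5 + \<epsilon> * s5\<^sup>2 \<noteq> 0"
    and "w0 = (s5 + (6 * s5 - 12) * \<epsilon>) / s5"
    and "s2 = (6 * s5 - 12) / (s5 - 6)"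
    and "s4 = (12 * \<epsilon> * s5\<^sup>2 - 24 * \<epsilon> * s5 + 2 * s5\<^sup>2)
              / (2 * s5 - 36 * \<epsilon> + 24 * \<epsilon> * s5 + \<epsilon> * s5\<^sup>2)"
    and "w0 \<in> {0<..<1}" and "s2 \<in> {0<..<2}" and "s4 \<in> {0<..<2}"
  shows "\<epsilon> = (1 - w0) / 2 * (1 / s2 - 1 / 2)
    \<and> slfd_accuracy \<kappa> R \<epsilon> w0 s2 s4 s5 (\<lambda>dx dt. dt\<^sup>2 + dx ^ 4 + dx\<^sup>2 * dt)
    \<and> slfd_accuracy \<kappa> R \<epsilon> w0 s2 s4 s5 (\<lambda>dx dt. dx ^ 4)
    \<and> (\<forall>s1\<in>{0<..<2}.
         (\<forall>dx > 0. let dt = \<epsilon> * dx\<^sup>2 / \<kappa> in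
            \<forall>f. mrt_lb_run w0 s1 s2 s4 s5 R dx dt f \<longrightarrow>
              (\<forall>n\<ge>4. \<forall>r. lb_phi dt R f (n + 1) r = slfd_rhs w0 s2 s4 s5 R dt (lb_phi dt R f) n r))
         \<and> mrt_lb_accuracy \<kappa> R \<epsilon> w0 s1 s2 s4 s5 (\<lambda>dx dt. dx ^ 4))"
proof -
  have s: "s5 \<noteq> 0" "s5 \<noteq> 2" "s2 > 0" "s4 > 0" "s5 > 0" using assms by auto
  note rel = slfd_parameter_relations[OF s(1,2) assms(4-8)]
  have "slfd_delta s2 s4 s5 > 0" using s by (simp add: slfd_delta_def)
  then have acc: "slfd_accuracy \<kappa> R \<epsilon> w0 s2 s4 s5 (\<lambda>dx dt. dx ^ 4)"
    using slfd_accuracy_fourth_order[OF assms(1,2) _ slfd_exact_heat_polynomial[OF rel]] by blast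
  have "\<epsilon> = (1 - w0) / 2 * (1 / s2 - 1 / 2)" using rel(1) s by (simp add: field_simps)
  moreover have "slfd_accuracy \<kappa> R \<epsilon> w0 s2 s4 s5 (\<lambda>dx dt. dt\<^sup>2 + dx ^ 4 + dx\<^sup>2 * dt)"
    by (rule slfd_accuracy_mono[OF acc]) (use assms(1,2) in auto)
  moreover have "lb_phi dt R f (n + 1) r = slfd_rhs w0 s2 s4 s5 R dt (lb_phi dt R f) n r"
    if "dx > 0" "dt = \<epsilon> * dx\<^sup>2 / \<kappa>" "mrt_lb_run w0 s1 s2 s4 s5 R dx dt f" "n \<ge> 4" for s1 dx dt f n r
    using mrt_lb_run_slfd[OF that(3,1) _ that(4)] assms(1,2) that(1,2) by simp
  ultimately show ?thesis
    using acc mrt_lb_accuracy_if_slfd_accuracy[OF assms(1,2) acc] by (simp add: Let_def)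
qed

end
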